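(* Let $p\in[0,\tfrac12)$ and $p_2,p_3\in[0,\tfrac12]$. Let $S,X_1,X_2,Y$ be $\{0,1\}$-valued random variables such that $(S,X_1)\sim\mathrm{DSBS}(p)$, $(X_1,Y)\sim\mathrm{DSBS}(p_2)$, $(X_2,Y)\sim\mathrm{DSBS}(p_3)$, and such that the Markov chains $S-X_1-(X_2,Y)$ and $X_1-Y-X_2$ hold. Let the reconstruction alphabets be $\hat{\mathcal X}_1=\hat{\mathcal X}_2=\hat{\mathcal S}=\{0,1\}$ and let $d_1,d_2,d_s$ all be Hamming distortion. Then for all $D_1\ge0$, $D_2\ge 0$, $D_s\ge p$, the rate-distortion function is $$R(D_1,D_2,D_s)=\big[h_b(p_3)-h_b(D_2)\big]\cdot\mathbf 1_{\{0\le D_2\le p_3\}}+\big[h_b(p_2)-h_b\big(\min\{D_1,D_s^0\}\big)\big]\cdot\mathbf 1_{\{0\le \min\{D_1,D_s^0\}\le p_2\}},$$ where $D_s^0=\frac{D_s-p}{1-2p}$.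
   Context: $\mathrm{DSBS}(q)$ (doubly symmetric binary source with parameter $q$) is the distribution on $\{0,1\}^2$ with $P(0,0)=P(1,1)=\frac{1-q}{2}$ and $P(0,1)=P(1,0)=\frac q2$. $h_b(q)=-q\log_2 q-(1-q)\log_2(1-q)$ is the binary entropy function, and $\mathbf 1_A$ is the indicator of $A$ (a term whose indicator vanishes is $0$). Under the stated hypotheses $(X_1,X_2)\sim\mathrm{DSBS}(p_1)$ with $p_1=p_2(1-p_3)+p_3(1-p_2)$. Rate-distortion function: let $(S_i,X_{1,i},X_{2,i},Y_i)$ be i.i.d. copies of $(S,X_1,X_2,Y)$. For sequences, distortions are per-letter averages, e.g. $d_1(x_1^n,\hat x_1^n)=\frac1n\sum_{i=1}^n d_1(x_{1,i},\hat x_{1,i})$. An $(n,2^{nR})$ code consists of an encoding function $\mathcal X_1^n\times\mathcal X_2^n\times\mathcal Y^n\to\{1,2,\dots,2^{nR}\}$ and a decoding function $\{1,2,\dots,2^{nR}\}\times\mathcal Y^n\to\hat{\mathcal X}_1^n\times\hat{\mathcal X}_2^n\times\hat{\mathcal S}^n$, producing $(\hat X_1^n,\hat X_2^n,\hat S^n)$. A nonnegative tuple $(R,D_1,D_2,D_s)$ is achievable if for all sufficiently large $n$ there exist $(n,2^{nR})$ codes such that $\lim_{n\to\infty}\mathbb E d_1(X_1^n,\hat X_1^n)\le D_1$, $\lim_{n\to\infty}\mathbb E d_2(X_2^n,\hat X_2^n)\le D_2$ and $\lim_{n\to\infty}\mathbb E d_s(S^n,\hat S^n)\le D_s$. $R(D_1,D_2,D_s)$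 is the infimum of all $R$ such that $(R,D_1,D_2,D_s)$ is achievable. The paper shows that it equals the minimum of $I(X_1,X_2;\hat X_1,\hat X_2,\hat S|Y)$ over conditional pmfs $p(\hat x_1,\hat x_2,\hat s|x_1,x_2,y)$ with $\mathbb E d_1(X_1,\hat X_1)\le D_1$, $\mathbb E d_2(X_2,\hat X_2)\le D_2$, $\mathbb E d_s'(X_1,\hat S)\le D_s$, where $d_s'(x_1,\hat s)=\sum_{s}p(s|x_1)d_s(s,\hat s)$. *)

theory Defs
  imports "HOL-Probability.Probability"
begin

text \<open>Binary alphabets are rendered by the type \<^typ>\<open>bool\<close>, with
  \<^term>\<open>False\<close> for 0 and \<^term>\<open>True\<close> for 1.\<close>

definition DSBS :: "'w measure \<Rightarrow> real \<Rightarrow> ('w \<Rightarrow> bool) \<Rightarrow> ('w \<Rightarrow> bool) \<Rightarrow> bool" where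
  "DSBS M q A B \<longleftrightarrow>
     \<P>(\<omega> in M. A \<omega> = False \<and> B \<omega> = False) = (1 - q) / 2 \<and>
     \<P>(\<omega> in M. A \<omega> = True \<and> B \<omega> = True) = (1 - q) / 2 \<and>
     \<P>(\<omega> in M. A \<omega> = False \<and> B \<omega> = True) = q / 2 \<and>
     \<P>(\<omega> in M. A \<omega> = True \<and> B \<omega> = False) = q / 2"

text \<open>The Markov chain A - B - C for discrete random variables: A and C are conditionally
  independent given B. Where B = b has probability 0, all the conditional probabilities are 0,
  so no condition is imposed there.\<close>

definition markov_chain ::
    "'w measure \<Rightarrow> ('w \<Rightarrow> 'a) \<Rightarrow> ('w \<Rightarrow> 'b) \<Rightarrow> ('w \<Rightarrow> 'c) \<Rightarrow> bool" where
  "markov_chain M A B C \<longleftrightarrow>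
     (\<forall>a b c. \<P>(\<omega> in M. A \<omega> = a \<and> C \<omega> = c \<bar> B \<omega> = b) =
              \<P>(\<omega> in M. A \<omega> = a \<bar> B \<omega> = b) * \<P>(\<omega> in M. C \<omega> = c \<bar> B \<omega> = b))"

text \<open>Meaningful when \<^term>\<open>M\<close> is a probability space and \<^term>\<open>Z\<close> is a
  random variable with values in a finite (or countable) type.\<close>

definition pmf_of_rv :: "'w measure \<Rightarrow> ('w \<Rightarrow> 'a) \<Rightarrow> 'a pmf" where
  "pmf_of_rv M Z = embed_pmf (\<lambda>z. \<P>(\<omega> in M. Z \<omega> = z))"

text \<open>With the convention 0 * log 0 = 0, which holds because \<^term>\<open>log 2 0\<close> is a real
  number.\<close>

definition h_b :: "real \<Rightarrow> real" where
  "h_b q = - q * log 2 q - (1 - q) * log 2 (1 - q)"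

definition hamming :: "'a \<Rightarrow> 'a \<Rightarrow> real" where
  "hamming x x' = (if x = x' then 0 else 1)"

definition avg_distortion :: "('a \<Rightarrow> 'b \<Rightarrow> real) \<Rightarrow> nat \<Rightarrow> 'a list \<Rightarrow> 'b list \<Rightarrow> real" where
  "avg_distortion d n xs xs' = (1 / real n) * (\<Sum>i<n. d (xs ! i) (xs' ! i))"

text \<open>Sequences of length n are lists of length n. The number 2 to the power nR need not be an
  integer; the messages are the positive integers not exceeding it.\<close>

definition messages :: "nat \<Rightarrow> real \<Rightarrow> nat set" where
  "messages n R = {m. 1 \<le> m \<and> real m \<le> 2 powr (real n * R)}"

type_synonym ('x1, 'x2, 'y) encoder = "'x1 list \<Rightarrow> 'x2 list \<Rightarrow> 'y list \<Rightarrow> nat"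

type_synonym ('y, 'x1h, 'x2h, 'sh) decoder =
  "nat \<Rightarrow> 'y list \<Rightarrow> 'x1h list \<times> 'x2h list \<times> 'sh list"

definition is_code ::
    "nat \<Rightarrow> real \<Rightarrow> ('x1, 'x2, 'y) encoder \<Rightarrow> ('y, 'x1h, 'x2h, 'sh) decoder \<Rightarrow> bool" where
  "is_code n R f g \<longleftrightarrow>
     (\<forall>x1 x2 y. length x1 = n \<and> length x2 = n \<and> length y = n \<longrightarrow> f x1 x2 y \<in> messages n R) \<and>
     (\<forall>m y. m \<in> messages n R \<and> length y = n \<longrightarrow>
        (case g m y of (x1h, x2h, sh) \<Rightarrow> length x1h = n \<and> length x2h = n \<and> length sh = n))"

text \<open>A sample of n i.i.d. copies of (S, X1, X2, Y) is drawn, and the output of the given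
  code is passed, along with the source sequences, to the cost function \<^term>\<open>c\<close>.\<close>

definition code_expectation ::
    "('s \<times> 'x1 \<times> 'x2 \<times> 'y) pmf \<Rightarrow> nat \<Rightarrow>
     ('x1, 'x2, 'y) encoder \<Rightarrow> ('y, 'x1h, 'x2h, 'sh) decoder \<Rightarrow>
     ('s list \<Rightarrow> 'x1 list \<Rightarrow> 'x2 list \<Rightarrow> 'x1h list \<Rightarrow> 'x2h list \<Rightarrow> 'sh list \<Rightarrow> real) \<Rightarrow> real" where
  "code_expectation P n f g c =
     measure_pmf.expectation (replicate_pmf n P) (\<lambda>z.
       let s = map (\<lambda>(s, x1, x2, y). s) z;
           x1 = map (\<lambda>(s, x1, x2, y). x1) z;
           x2 = map (\<lambda>(s, x1, x2, y). x2) z;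
           y = map (\<lambda>(s, x1, x2, y). y) z;
           (x1h, x2h, sh) = g (f x1 x2 y) y
       in c s x1 x2 x1h x2h sh)"

definition achievable ::
    "('s::finite \<times> 'x1::finite \<times> 'x2::finite \<times> 'y::finite) pmf \<Rightarrow>
     ('x1 \<Rightarrow> 'x1h::finite \<Rightarrow> real) \<Rightarrow> ('x2 \<Rightarrow> 'x2h::finite \<Rightarrow> real) \<Rightarrow> ('s \<Rightarrow> 'sh::finite \<Rightarrow> real) \<Rightarrow>
     real \<Rightarrow> real \<Rightarrow> real \<Rightarrow> real \<Rightarrow> bool" where
  "achievable P d1 d2 ds R D1 D2 Ds \<longleftrightarrow>
     0 \<le> R \<and> 0 \<le> D1 \<and> 0 \<le> D2 \<and> 0 \<le> Ds \<and>
     (\<exists>(f :: nat \<Rightarrow> ('x1, 'x2, 'y) encoder) (g :: nat \<Rightarrow> ('y, 'x1h, 'x2h, 'sh) decoder).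
        (\<forall>\<^sub>F n in sequentially. is_code n R (f n) (g n)) \<and>
        (\<exists>l\<le>D1. (\<lambda>n. code_expectation P n (f n) (g n)
            (\<lambda>s x1 x2 x1h x2h sh. avg_distortion d1 n x1 x1h)) \<longlonglongrightarrow> l) \<and>
        (\<exists>l\<le>D2. (\<lambda>n. code_expectation P n (f n) (g n)
            (\<lambda>s x1 x2 x1h x2h sh. avg_distortion d2 n x2 x2h)) \<longlonglongrightarrow> l) \<and>
        (\<exists>l\<le>Ds. (\<lambda>n. code_expectation P n (f n) (g n)
            (\<lambda>s x1 x2 x1h x2h sh. avg_distortion ds n s sh)) \<longlonglongrightarrow> l))"

definition rate_distortion ::
    "('s::finite \<times> 'x1::finite \<times> 'x2::finite \<times> 'y::finite) pmf \<Rightarrow>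
     ('x1 \<Rightarrow> 'x1h::finite \<Rightarrow> real) \<Rightarrow> ('x2 \<Rightarrow> 'x2h::finite \<Rightarrow> real) \<Rightarrow> ('s \<Rightarrow> 'sh::finite \<Rightarrow> real) \<Rightarrow>
     real \<Rightarrow> real \<Rightarrow> real \<Rightarrow> real" where
  "rate_distortion P d1 d2 ds D1 D2 Ds = Inf {R. achievable P d1 d2 ds R D1 D2 Ds}"

end

theory Submission
  imports Defs "HOL-Real_Asymp.Real_Asymp"
begin

text \<open>Adding Y (modulo 2) turns X1 and X2 into independent Bernoulli sequences Z1 and Z2 that are
  independent of the side information, and S is X1 plus independent noise, so a Hamming distortion d
  between X1 and a reconstruction becomes p + (1 - 2p) d between S and that reconstruction.

  Converse: for a codebook of N words, a letterwise kernel v and the word \<open>\<phi> z\<close> that the code assigns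
  to z, summing over all codewords shows that the product of the ratios \<open>v (\<phi> z)\<^sub>i z\<^sub>i / P z\<^sub>i\<close> has
  expectation at most N, hence by ln x \<open>\<le>\<close> x - 1 its logarithm has expectation at most ln N. For v
  the optimal backward test channel this is linear in the distortion and yields the rate bound.

  Achievability: Z1 and Z2 are quantized separately. Codewords are chosen greedily, each covering
  at least a fraction 2 to the power -n(I + \<open>\<delta>\<close>) of what is still uncovered up to the probability
  of the atypical set; this fraction comes from a change of measure on the typical set.\<close>

section \<open>Independent identically distributed sequences\<close>

lemma replicate_pmf_Suc_pair:
  "replicate_pmf (Suc n) p = map_pmf (\<lambda>(x, xs). x # xs) (pair_pmf p (replicate_pmf n p))"
  by (simp add: pair_pmf_def map_bind_pmf bind_assoc_pmf bind_return_pmf)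

lemma finite_set_replicate_pmf [simp]:
  "finite (set_pmf (replicate_pmf n (p :: 'a::finite pmf)))"
proof (rule finite_subset)
  show "set_pmf (replicate_pmf n p) \<subseteq> {xs. set xs \<subseteq> UNIV \<and> length xs = n}"
    by (auto simp: set_replicate_pmf)
qed (rule finite_lists_length_eq, simp)

lemma length_set_replicate_pmf: "xs \<in> set_pmf (replicate_pmf n p) \<Longrightarrow> length xs = n"
  by (auto simp: set_replicate_pmf)

lemma expectation_bind_pmf_finite:
  fixes h :: "'b \<Rightarrow> real"
  assumes "finite (set_pmf p)" "\<And>x. x \<in> set_pmf p \<Longrightarrow> finite (set_pmf (f x))"
  shows "measure_pmf.expectation (bind_pmf p f) h =
    measure_pmf.expectation p (\<lambda>x. measure_pmf.expectation (f x) h)"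
  by (subst pmf_expectation_bind[of "set_pmf p"])
    (use assms in \<open>auto simp: integral_measure_pmf[of "set_pmf p"]\<close>)

lemma expectation_pair_pmf_finite:
  fixes h :: "'a \<times> 'b \<Rightarrow> real"
  assumes "finite (set_pmf p)" "finite (set_pmf q)"
  shows "measure_pmf.expectation (pair_pmf p q) h =
    measure_pmf.expectation p (\<lambda>x. measure_pmf.expectation q (\<lambda>y. h (x, y)))"
  unfolding pair_pmf_def using assms by (simp add: expectation_bind_pmf_finite)

lemma expectation_replicate_pmf_Suc:
  fixes h :: "'a::finite list \<Rightarrow> real"
  shows "measure_pmf.expectation (replicate_pmf (Suc n) p) h =
    measure_pmf.expectation p (\<lambda>x. measure_pmf.expectation (replicate_pmf n p) (\<lambda>xs. h (x # xs)))"
  unfolding replicate_pmf_Suc_pair by (simp add: expectation_pair_pmf_finite case_prod_beta)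

lemma pmf_replicate_pmf:
  "pmf (replicate_pmf n p) xs = (if length xs = n then \<Prod>i<n. pmf p (xs ! i) else 0)"
proof (induction n arbitrary: xs)
  case 0
  then show ?case by (simp add: pmf_return)
next
  case (Suc n)
  show ?case
  proof (cases xs)
    case Nil
    have "xs \<notin> set_pmf (replicate_pmf (Suc n) p)"
      using Nil by (auto dest: length_set_replicate_pmf)
    then show ?thesis using Nil by (simp add: set_pmf_iff del: replicate_pmf.simps)
  next
    case (Cons y ys)
    have "pmf (replicate_pmf (Suc n) p) xs = pmf (pair_pmf p (replicate_pmf n p)) (y, ys)"
      unfolding replicate_pmf_Suc_pair Cons
      using pmf_map_inj'[of "\<lambda>(x, xs). x # xs" "pair_pmf p (replicate_pmf n p)" "(y, ys)"]
      by (auto simp: inj_def)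
    then show ?thesis
      using Suc by (simp add: pmf_pair Cons prod.lessThan_Suc_shift del: replicate_pmf.simps prod.lessThan_Suc)
  qed
qed

lemma map_replicate_pmf: "map_pmf (map f) (replicate_pmf n p) = replicate_pmf n (map_pmf f p)"
proof (induction n)
  case (Suc n)
  then show ?case
    by (simp flip: Suc.IH add: map_bind_pmf bind_map_pmf)
qed simp

text \<open>Unzipping is injective, so point masses can be compared at \<open>zip xs ys\<close>; if
  one of the lists does not have length n, both sides give mass 0.\<close>

lemma pair_replicate_pmf:
  "pair_pmf (replicate_pmf n p) (replicate_pmf n q) =
    map_pmf (\<lambda>zs. (map fst zs, map snd zs)) (replicate_pmf n (pair_pmf p q))"
proof (rule pmf_eqI, clarify)
  fix xs ys
  let ?f = "\<lambda>zs :: ('a \<times> 'b) list. (map fst zs, map snd zs)"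
  have inj: "inj ?f"
    by (rule injI) (metis Pair_inject zip_map_fst_snd)
  show "pmf (pair_pmf (replicate_pmf n p) (replicate_pmf n q)) (xs, ys) =
    pmf (map_pmf ?f (replicate_pmf n (pair_pmf p q))) (xs, ys)"
  proof (cases "length xs = n \<and> length ys = n")
    case True
    have "pmf (map_pmf ?f (replicate_pmf n (pair_pmf p q))) (?f (zip xs ys)) =
      pmf (replicate_pmf n (pair_pmf p q)) (zip xs ys)"
      by (rule pmf_map_inj'[OF inj])
    then show ?thesis
      using True by (simp add: pmf_pair pmf_replicate_pmf prod.distrib)
  next
    case False
    then have "(xs, ys) \<notin> set_pmf (map_pmf ?f (replicate_pmf n (pair_pmf p q)))"
      by (auto dest: length_set_replicate_pmf)
    then show ?thesis
      using False by (simp only: pmf_pair pmf_replicate_pmf set_pmf_iff) auto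
  qed
qed

text \<open>Allows one component sequence to be frozen while averaging over the other; side
  information and noise are separated this way later.\<close>

lemma expectation_replicate_pair_pmf:
  fixes h :: "'a::finite list \<Rightarrow> 'b::finite list \<Rightarrow> real"
  shows "measure_pmf.expectation (replicate_pmf n (pair_pmf p q)) (\<lambda>zs. h (map fst zs) (map snd zs)) =
    measure_pmf.expectation (replicate_pmf n p)
      (\<lambda>xs. measure_pmf.expectation (replicate_pmf n q) (\<lambda>ys. h xs ys))"
proof -
  have "measure_pmf.expectation (replicate_pmf n (pair_pmf p q)) (\<lambda>zs. h (map fst zs) (map snd zs)) =
    measure_pmf.expectation (map_pmf (\<lambda>zs. (map fst zs, map snd zs)) (replicate_pmf n (pair_pmf p q)))
      (\<lambda>(xs, ys). h xs ys)"
    by simp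
  then show ?thesis
    unfolding pair_replicate_pmf[symmetric] by (simp add: expectation_pair_pmf_finite)
qed

section \<open>Moments of iid sums and the weak law of large numbers\<close>

lemma integrable_finite [simp]:
  fixes f :: "'a::finite \<Rightarrow> real"
  shows "integrable (measure_pmf p) f"
  by (simp add: integrable_measure_pmf_finite)

lemma integrable_replicate_pmf [simp]:
  fixes f :: "'a::finite list \<Rightarrow> real"
  shows "integrable (measure_pmf (replicate_pmf n p)) f"
  by (simp add: integrable_measure_pmf_finite)

lemma expectation_replicate_pmf_sum:
  fixes g :: "nat \<Rightarrow> 'a::finite \<Rightarrow> real"
  shows "measure_pmf.expectation (replicate_pmf n p) (\<lambda>xs. \<Sum>i<n. g i (xs ! i)) =
    (\<Sum>i<n. measure_pmf.expectation p (g i))"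
proof (induction n arbitrary: g)
  case (Suc n)
  then show ?case
    by (simp add: expectation_replicate_pmf_Suc sum.lessThan_Suc_shift
        del: replicate_pmf.simps sum.lessThan_Suc)
qed simp

lemma expectation_iid_sum:
  fixes g :: "'a::finite \<Rightarrow> real"
  shows "measure_pmf.expectation (replicate_pmf n p) (\<lambda>xs. \<Sum>i<n. g (xs ! i)) =
    real n * measure_pmf.expectation p g"
  by (simp add: expectation_replicate_pmf_sum[of n p "\<lambda>_. g"])

text \<open>Splitting off the first letter leaves a cross term with the factor E g = 0, so only the
  n individual second moments survive.\<close>

lemma expectation_iid_sum_squared:
  fixes g :: "'a::finite \<Rightarrow> real"
  assumes "measure_pmf.expectation p g = 0"
  shows "measure_pmf.expectation (replicate_pmf n p) (\<lambda>xs. (\<Sum>i<n. g (xs ! i))\<^sup>2) =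
    real n * measure_pmf.expectation p (\<lambda>x. (g x)\<^sup>2)"
proof (induction n)
  case (Suc n)
  then show ?case
    by (simp add: expectation_replicate_pmf_Suc sum.lessThan_Suc_shift algebra_simps power2_sum
        expectation_iid_sum assms
        del: replicate_pmf.simps sum.lessThan_Suc)
qed simp

text \<open>Chebyshev's inequality: the centred sum has second moment n V, where V is the variance
  of one letter, so the probability is at most V / (n \<epsilon> \<epsilon>).\<close>

lemma weak_law_replicate_pmf:
  fixes g :: "'a::finite \<Rightarrow> real"
  assumes "\<epsilon> > 0"
  shows "(\<lambda>n. measure_pmf.prob (replicate_pmf n p)
      {xs. \<bar>(\<Sum>i<n. g (xs ! i)) - real n * measure_pmf.expectation p g\<bar> \<ge> real n * \<epsilon>}) \<longlonglongrightarrow> 0"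
proof (rule real_tendsto_sandwich[where f = "\<lambda>_. 0"])
  let ?m = "measure_pmf.expectation p g"
  let ?V = "measure_pmf.expectation p (\<lambda>x. (g x - ?m)\<^sup>2)"
  show "(\<lambda>n. ?V / \<epsilon>\<^sup>2 * inverse (real n)) \<longlonglongrightarrow> 0"
    by (rule tendsto_mult_right_zero, rule lim_inverse_n)
  show "\<forall>\<^sub>F n in sequentially. measure_pmf.prob (replicate_pmf n p)
      {xs. \<bar>(\<Sum>i<n. g (xs ! i)) - real n * ?m\<bar> \<ge> real n * \<epsilon>} \<le> ?V / \<epsilon>\<^sup>2 * inverse (real n)"
    using eventually_gt_at_top[of 0]
  proof eventually_elim
    case (elim n)
    have "measure_pmf.prob (replicate_pmf n p) {xs \<in> space (replicate_pmf n p).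
        real n * \<epsilon> \<le> \<bar>(\<Sum>i<n. g (xs ! i)) - real n * ?m\<bar>} =
      measure_pmf.prob (replicate_pmf n p) {xs \<in> space (replicate_pmf n p).
        real n * \<epsilon> \<le> \<bar>\<Sum>i<n. g (xs ! i) - ?m\<bar>}"
      by (simp add: sum_subtractf)
    also have "\<dots> \<le> measure_pmf.expectation (replicate_pmf n p) (\<lambda>xs. (\<Sum>i<n. g (xs ! i) - ?m)\<^sup>2) /
        (real n * \<epsilon>)\<^sup>2"
      by (rule measure_pmf.second_moment_method) (use elim assms in auto)
    also have "\<dots> = real n * ?V / (real n * \<epsilon>)\<^sup>2"
      by (subst expectation_iid_sum_squared[where g = "\<lambda>x. g x - ?m"]) auto
    also have "\<dots> = ?V / \<epsilon>\<^sup>2 * inverse (real n)"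
      using elim by (simp add: power2_eq_square divide_inverse mult_ac)
    finally show ?case by simp
  qed
qed auto

section \<open>Converse and covering bounds for finite alphabets\<close>

lemma finite_lists_of_length [simp]: "finite {xs :: 'a::finite list. length xs = n}"
  using finite_lists_length_eq[of "UNIV :: 'a set" n] by simp

text \<open>The sum factors over positions, each factor being the mass of one kernel. The induction
  generalizes \<open>c\<close> because the tail of the list uses \<open>c (Suc i)\<close>.\<close>

lemma sum_prod_lists_le_1:
  fixes v :: "'c \<Rightarrow> 'z::finite \<Rightarrow> real"
  assumes "\<And>c z. 0 \<le> v c z" "\<And>c. (\<Sum>z\<in>UNIV. v c z) \<le> 1"
  shows "(\<Sum>zs | length zs = n. \<Prod>i<n. v (c i) (zs ! i)) \<le> 1"
proof (induction n arbitrary: c)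
  case (Suc n)
  have "bij_betw (\<lambda>(z, zs). z # zs) (UNIV \<times> {zs. length zs = n}) {zs :: 'z list. length zs = Suc n}"
    by (auto simp: bij_betw_def inj_on_def length_Suc_conv)
  then have "(\<Sum>zs | length zs = Suc n. \<Prod>i<Suc n. v (c i) (zs ! i)) =
      (\<Sum>(z, zs)\<in>UNIV \<times> {zs. length zs = n}. \<Prod>i<Suc n. v (c i) ((z # zs) ! i))"
    by (subst sum.reindex_bij_betw[symmetric, of "\<lambda>(z, zs). z # zs"]) (auto simp: case_prod_beta)
  also have "\<dots> = (\<Sum>z\<in>UNIV. v (c 0) z) * (\<Sum>zs | length zs = n. \<Prod>i<n. v (c (Suc i)) (zs ! i))"
    by (simp add: sum.cartesian_product[symmetric] prod.lessThan_Suc_shift sum_product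
        del: prod.lessThan_Suc)
  also have "\<dots> \<le> 1 * 1"
    by (intro mult_mono Suc assms sum_nonneg prod_nonneg) auto
  finally show ?case by simp
qed simp

text \<open>Here \<open>\<phi>\<close> is the encoder and \<open>c m i\<close> is letter i of
  codeword m. The code enters the bound only through the number of its messages.\<close>

lemma expected_log_likelihood_ratio_le:
  fixes p :: "'z::finite pmf" and v :: "'c \<Rightarrow> 'z \<Rightarrow> real"
  assumes v: "\<And>c z. 0 \<le> v c z" "\<And>c. (\<Sum>z\<in>UNIV. v c z) \<le> 1"
    and pos: "\<And>c z. z \<in> set_pmf p \<Longrightarrow> 0 < v c z"
    and "finite K" and \<phi>: "\<And>zs. length zs = n \<Longrightarrow> \<phi> zs \<in> K"
  shows "measure_pmf.expectation (replicate_pmf n p)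
      (\<lambda>zs. \<Sum>i<n. ln (v (c (\<phi> zs) i) (zs ! i) / pmf p (zs ! i))) \<le> ln (real (card K))"
proof -
  let ?E = "measure_pmf.expectation (replicate_pmf n p)"
  let ?N = "real (card K)"
  define X where "X zs = (\<Prod>i<n. v (c (\<phi> zs) i) (zs ! i) / pmf p (zs ! i))" for zs
  obtain zs0 :: "'z list" where "length zs0 = n"
    using Ex_list_of_length by blast
  then have N: "?N > 0"
    using \<phi> \<open>finite K\<close> by (fastforce simp: card_gt_0_iff)
  have in_supp: "zs ! i \<in> set_pmf p" if "zs \<in> set_pmf (replicate_pmf n p)" "i < n" for zs i
    using that by (auto simp: set_replicate_pmf)
  have "?E X = (\<Sum>zs\<in>set_pmf (replicate_pmf n p). pmf (replicate_pmf n p) zs * X zs)"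
    by (subst integral_measure_pmf[of "set_pmf (replicate_pmf n p)"]) auto
  also have "\<dots> = (\<Sum>zs\<in>set_pmf (replicate_pmf n p). \<Prod>i<n. v (c (\<phi> zs) i) (zs ! i))"
  proof (rule sum.cong)
    fix zs assume zs: "zs \<in> set_pmf (replicate_pmf n p)"
    have "pmf (replicate_pmf n p) zs * X zs =
      (\<Prod>i<n. pmf p (zs ! i) * (v (c (\<phi> zs) i) (zs ! i) / pmf p (zs ! i)))"
      using length_set_replicate_pmf[OF zs] by (simp add: X_def pmf_replicate_pmf prod.distrib del: times_divide_eq_right)
    also have "\<dots> = (\<Prod>i<n. v (c (\<phi> zs) i) (zs ! i))"
      using in_supp[OF zs] by (intro prod.cong) (auto simp: set_pmf_iff)
    finally show "pmf (replicate_pmf n p) zs * X zs = (\<Prod>i<n. v (c (\<phi> zs) i) (zs ! i))" .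
  qed simp
  also have "\<dots> \<le> (\<Sum>zs | length zs = n. \<Prod>i<n. v (c (\<phi> zs) i) (zs ! i))"
    by (intro sum_mono2 prod_nonneg) (auto simp: v dest: length_set_replicate_pmf)
  \<comment> \<open>The index chosen by \<open>\<phi>\<close> is one of those in \<open>K\<close>,
    so summing over all of them can only increase a nonnegative sum. Afterwards the codeword no
    longer depends on \<open>zs\<close>, and each inner sum is the mass of a product kernel.\<close>
  also have "\<dots> \<le> (\<Sum>zs | length zs = n. \<Sum>m\<in>K. \<Prod>i<n. v (c m i) (zs ! i))"
    by (intro sum_mono member_le_sum[where f = "\<lambda>m. \<Prod>i<n. v (c m i) (_ ! i)"] prod_nonneg)
      (use \<phi> v \<open>finite K\<close> in auto)
  also have "\<dots> = (\<Sum>m\<in>K. \<Sum>zs | length zs = n. \<Prod>i<n. v (c m i) (zs ! i))"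
    by (rule sum.swap)
  also have "\<dots> \<le> (\<Sum>m\<in>K. 1)"
    by (intro sum_mono sum_prod_lists_le_1 v)
  finally have EX: "?E X \<le> ?N" by simp
  \<comment> \<open>Applying ln x \<le> x - 1 at X / N instead of X makes the terms X / N - 1
    nonpositive in expectation and leaves exactly ln N.\<close>
  have "?E (\<lambda>zs. \<Sum>i<n. ln (v (c (\<phi> zs) i) (zs ! i) / pmf p (zs ! i))) \<le>
      ?E (\<lambda>zs. X zs / ?N - 1 + ln ?N)"
  proof (rule integral_mono_AE)
    show "AE zs in replicate_pmf n p. (\<Sum>i<n. ln (v (c (\<phi> zs) i) (zs ! i) / pmf p (zs ! i))) \<le>
      X zs / ?N - 1 + ln ?N"
    proof (rule AE_pmfI)
      fix zs assume zs: "zs \<in> set_pmf (replicate_pmf n p)"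
      have pos': "v (c (\<phi> zs) i) (zs ! i) / pmf p (zs ! i) > 0" if "i < n" for i
        using pos[OF in_supp[OF zs that]] in_supp[OF zs that] by (simp add: pmf_positive)
      have X: "X zs > 0"
        unfolding X_def by (rule prod_pos) (use pos' in auto)
      have "(\<Sum>i<n. ln (v (c (\<phi> zs) i) (zs ! i) / pmf p (zs ! i))) = ln (X zs)"
        unfolding X_def by (rule ln_prod[symmetric]) (simp, metis lessThan_iff less_irrefl pos')
      also have "\<dots> = ln (X zs / ?N) + ln ?N"
        using X N by (simp add: ln_div)
      also have "ln (X zs / ?N) \<le> X zs / ?N - 1"
        by (rule ln_le_minus_one) (use X N in auto)
      finally show "(\<Sum>i<n. ln (v (c (\<phi> zs) i) (zs ! i) / pmf p (zs ! i))) \<le>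
        X zs / ?N - 1 + ln ?N" by simp
    qed
  qed auto
  also have "\<dots> = ?E X / ?N - 1 + ln ?N" by simp
  also have "\<dots> \<le> ln ?N" using EX N by simp
  finally show ?thesis .
qed

section \<open>Greedy covering by typical codewords\<close>

lemma exists_ge_expectation:
  fixes f :: "'a \<Rightarrow> real"
  assumes "finite (set_pmf p)"
  obtains x where "x \<in> set_pmf p" "measure_pmf.expectation p f \<le> f x"
proof -
  obtain x where x: "x \<in> set_pmf p" "f x = Max (f ` set_pmf p)"
    using Max_in[of "f ` set_pmf p"] assms set_pmf_not_empty by fastforce
  have "measure_pmf.expectation p f \<le> f x"
    by (rule measure_pmf.integral_le_const)
      (use assms x in \<open>auto intro!: AE_pmfI integrable_measure_pmf_finite\<close>)
  with x that show ?thesis by blast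
qed

text \<open>Averaging argument: on good pairs \<open>\<alpha>\<close> times the joint law is
  dominated by the product law, so a codeword drawn from \<open>B\<close> covers on average at least
  the stated mass of \<open>U\<close>, and some codeword does no worse than the average.\<close>

lemma greedy_cover_step:
  fixes A :: "'a pmf" and B :: "'b pmf" and J :: "('a \<times> 'b) pmf"
  assumes fin: "finite (set_pmf A)" "finite (set_pmf B)" "finite (set_pmf J)"
    and A: "map_pmf fst J = A"
    and "0 \<le> \<alpha>"
    and \<eta>: "measure_pmf.prob J (- G) \<le> \<eta>"
    and G: "\<And>a b. (a, b) \<in> G \<Longrightarrow> (a, b) \<in> set_pmf J \<Longrightarrow>
      N a b \<and> \<alpha> * pmf J (a, b) \<le> pmf A a * pmf B b"
  obtains b where "b \<in> set_pmf B"
    "\<alpha> * (measure_pmf.prob A U - \<eta>) \<le> measure_pmf.prob A (U \<inter> {a. N a b})"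
proof -
  define H where "H = {(a, b). (a, b) \<in> G \<and> (a, b) \<in> set_pmf J \<and> a \<in> U}"
  have "finite H"
    by (rule finite_subset[OF _ fin(3)]) (auto simp: H_def)
  let ?Q = "{(b, a). a \<in> U \<and> N a b}"
  have "measure_pmf.prob A U = measure_pmf.prob J (fst -` U)"
    by (simp flip: A)
  also have "\<dots> = measure_pmf.prob J (fst -` U \<inter> set_pmf J)"
    by (simp add: measure_Int_set_pmf)
  also have "\<dots> \<le> measure_pmf.prob J (H \<union> - G)"
    by (rule measure_pmf.finite_measure_mono) (auto simp: H_def)
  also have "\<dots> \<le> measure_pmf.prob J H + measure_pmf.prob J (- G)"
    by (rule measure_Un_le) auto
  finally have "\<alpha> * (measure_pmf.prob A U - \<eta>) \<le> \<alpha> * measure_pmf.prob J H"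
    using \<eta> \<open>0 \<le> \<alpha>\<close> by (intro mult_left_mono) auto
  also have "\<dots> = (\<Sum>x\<in>H. \<alpha> * pmf J x)"
    using \<open>finite H\<close> by (simp add: measure_measure_pmf_finite sum_distrib_left)
  also have "\<dots> \<le> (\<Sum>x\<in>H. pmf (pair_pmf A B) x)"
    by (rule sum_mono) (use G in \<open>auto simp: H_def pmf_pair\<close>)
  also have "\<dots> = measure_pmf.prob (pair_pmf A B) H"
    using \<open>finite H\<close> by (simp add: measure_measure_pmf_finite)
  also have "\<dots> \<le> measure_pmf.prob (pair_pmf A B) {(a, b). a \<in> U \<and> N a b}"
    by (rule measure_pmf.finite_measure_mono) (use G in \<open>auto simp: H_def\<close>)
  \<comment> \<open>The factors are swapped so that the codeword becomes the outer variable of the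
    iterated expectation.\<close>
  also have "\<dots> = measure_pmf.prob (pair_pmf B A) ?Q"
    by (subst pair_commute_pmf) (auto intro!: arg_cong[where f = "measure_pmf.prob _"])
  also have "\<dots> = measure_pmf.expectation (pair_pmf B A) (indicator ?Q)"
    by simp
  also have "\<dots> = measure_pmf.expectation B (\<lambda>b. measure_pmf.expectation A (\<lambda>a. indicator (U \<inter> {a. N a b}) a))"
    by (subst expectation_pair_pmf_finite) (simp_all only: fin indicator_def[abs_def] mem_Collect_eq case_prod_conv Int_iff)
  also have "\<dots> = measure_pmf.expectation B (\<lambda>b. measure_pmf.prob A (U \<inter> {a. N a b}))"
    by simp
  finally have *: "\<alpha> * (measure_pmf.prob A U - \<eta>) \<le> \<dots>" .
  obtain b where "b \<in> set_pmf B" "measure_pmf.expectation B (\<lambda>b. measure_pmf.prob A (U \<inter> {a. N a b}))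
      \<le> measure_pmf.prob A (U \<inter> {a. N a b})"
    using exists_ge_expectation[OF fin(2)] by blast
  with * that show ?thesis by fastforce
qed

text \<open>Each greedy step multiplies the excess of the uncovered mass over \<open>\<eta>\<close>
  by at most 1 - \<open>\<alpha>\<close>; initially this excess is at most 1.\<close>

lemma greedy_cover:
  fixes A :: "'a pmf" and B :: "'b pmf" and J :: "('a \<times> 'b) pmf"
  assumes fin: "finite (set_pmf A)" "finite (set_pmf B)" "finite (set_pmf J)"
    and A: "map_pmf fst J = A"
    and \<alpha>: "0 \<le> \<alpha>" "\<alpha> \<le> 1"
    and \<eta>: "measure_pmf.prob J (- G) \<le> \<eta>"
    and G: "\<And>a b. (a, b) \<in> G \<Longrightarrow> (a, b) \<in> set_pmf J \<Longrightarrow>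
      N a b \<and> \<alpha> * pmf J (a, b) \<le> pmf A a * pmf B b"
  shows "\<exists>C. finite C \<and> card C \<le> k \<and> C \<subseteq> set_pmf B \<and>
    measure_pmf.prob A {a. \<forall>b\<in>C. \<not> N a b} \<le> \<eta> + (1 - \<alpha>) ^ k"
proof (induction k)
  case 0
  have "0 \<le> \<eta>" by (rule order_trans[OF measure_nonneg \<eta>])
  then show ?case by (intro exI[of _ "{}"]) auto
next
  case (Suc k)
  then obtain C where C: "finite C" "card C \<le> k" "C \<subseteq> set_pmf B"
    "measure_pmf.prob A {a. \<forall>b\<in>C. \<not> N a b} \<le> \<eta> + (1 - \<alpha>) ^ k" by blast
  let ?U = "{a. \<forall>b\<in>C. \<not> N a b}"
  obtain b where b: "b \<in> set_pmf B"
    "\<alpha> * (measure_pmf.prob A ?U - \<eta>) \<le> measure_pmf.prob A (?U \<inter> {a. N a b})"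
    using greedy_cover_step[where A = A and U = ?U, OF fin A \<alpha>(1) \<eta> G] by blast
  have "measure_pmf.prob A {a. \<forall>b\<in>insert b C. \<not> N a b} =
      measure_pmf.prob A (?U - (?U \<inter> {a. N a b}))"
    by (rule arg_cong[where f = "measure_pmf.prob A"]) auto
  also have "\<dots> = measure_pmf.prob A ?U - measure_pmf.prob A (?U \<inter> {a. N a b})"
    by (rule measure_pmf.finite_measure_Diff) auto
  also have "\<dots> \<le> \<eta> + (1 - \<alpha>) * (measure_pmf.prob A ?U - \<eta>)"
    using b by (simp add: algebra_simps)
  also have "\<dots> \<le> \<eta> + (1 - \<alpha>) * (1 - \<alpha>) ^ k"
    using C(4) \<alpha> by (intro add_left_mono mult_left_mono) auto
  finally show ?case
    using C b by (intro exI[of _ "insert b C"]) (auto intro: order_trans[OF card_insert_le_m1])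
qed

text \<open>\<open>I\<close> is the mutual information of \<open>J\<close> in bits and
  \<open>\<Delta>\<close> its expected distortion. The covering condition is two-sided, so that the
  distortion obtained is close to \<open>\<Delta>\<close> and not merely below it.\<close>

lemma lossy_covering:
  fixes J :: "('z::finite \<times> 'c::finite) pmf" and d :: "'z \<Rightarrow> 'c \<Rightarrow> real"
  defines "P \<equiv> map_pmf fst J" and "Q \<equiv> map_pmf snd J"
  defines "I \<equiv> measure_pmf.expectation J (\<lambda>(z, c). log 2 (pmf J (z, c) / (pmf P z * pmf Q c)))"
    and "\<Delta> \<equiv> measure_pmf.expectation J (\<lambda>(z, c). d z c)"
  assumes R: "I < R" "0 < R" and \<epsilon>: "0 < \<epsilon>" "\<epsilon> < 1"
  shows "\<forall>\<^sub>F n in sequentially. \<exists>C. finite C \<and> C \<noteq> {} \<and> real (card C) \<le> 2 powr (real n * R) \<and>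
    C \<subseteq> {cs. length cs = n} \<and>
    measure_pmf.prob (replicate_pmf n P)
      {zs. \<forall>cs\<in>C. \<not> \<bar>(\<Sum>i<n. d (zs ! i) (cs ! i)) - real n * \<Delta>\<bar> \<le> real n * \<epsilon>} \<le> \<epsilon>"
proof -
  define \<iota> where "\<iota> = (\<lambda>(z, c). log 2 (pmf J (z, c) / (pmf P z * pmf Q c)))"
  \<comment> \<open>The gap from I to a absorbs fluctuations of the information density, and the gap
    from a to R leaves enough codewords to cover. Positivity of a keeps 2 powr (- n a) at most
    1.\<close>
  obtain a where a: "I < a" "a < R" "0 < a"
    using R dense[of "max I 0" R] by auto
  let ?bad1 = "\<lambda>n. measure_pmf.prob (replicate_pmf n J)
    {\<omega>. real n * \<epsilon> \<le> \<bar>(\<Sum>i<n. case_prod d (\<omega> ! i)) - real n * \<Delta>\<bar>}"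
  let ?bad2 = "\<lambda>n. measure_pmf.prob (replicate_pmf n J)
    {\<omega>. real n * (a - I) \<le> \<bar>(\<Sum>i<n. \<iota> (\<omega> ! i)) - real n * I\<bar>}"
  have "?bad1 \<longlonglongrightarrow> 0" "?bad2 \<longlonglongrightarrow> 0"
    unfolding \<Delta>_def I_def \<iota>_def[symmetric]
    using weak_law_replicate_pmf[of _ J] \<epsilon> a by (auto simp: I_def \<iota>_def)
  then have "(\<lambda>n. ?bad1 n + ?bad2 n) \<longlonglongrightarrow> 0 + 0" by (rule tendsto_add)
  then have ev1: "\<forall>\<^sub>F n in sequentially. ?bad1 n + ?bad2 n < \<epsilon> / 2"
    using \<epsilon> by (intro order_tendstoD(2)) auto
  \<comment> \<open>The summand 1 pays for rounding 2 powr (n R) down to an integer number of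
    codewords: the loss is at most \<open>\<alpha>\<close>, which is at most 1.\<close>
  have "(\<lambda>n. exp (1 - 2 powr (real n * (R - a)))) \<longlonglongrightarrow> 0"
    using a by real_asymp
  then have ev2: "\<forall>\<^sub>F n in sequentially. exp (1 - 2 powr (real n * (R - a))) < \<epsilon> / 2"
    using \<epsilon> by (intro order_tendstoD(2)) auto
  show ?thesis
    using ev1 ev2
  proof eventually_elim
    case (elim n)
    define k where "k = nat \<lfloor>2 powr (real n * R)\<rfloor>"
    define \<alpha> :: real where "\<alpha> = 2 powr (- (real n * a))"
    have powr_le_1: "2 powr x \<le> (1 :: real)" if "x \<le> 0" for x :: real
      using powr_mono[of x 0 2] that by simp
    have \<alpha>: "0 \<le> \<alpha>" "\<alpha> \<le> 1" using a by (auto simp: \<alpha>_def intro!: powr_le_1)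
    define Jn where "Jn = map_pmf (\<lambda>\<omega>. (map fst \<omega>, map snd \<omega>)) (replicate_pmf n J)"
    define N where "N zs cs \<longleftrightarrow> \<bar>(\<Sum>i<n. d (zs ! i) (cs ! i)) - real n * \<Delta>\<bar> \<le> real n * \<epsilon>" for zs cs
    \<comment> \<open>The jointly typical pairs: distortion near its mean and total information
      density at most n a.\<close>
    define G where "G = {(zs, cs). N zs cs \<and> (\<Sum>i<n. \<iota> (zs ! i, cs ! i)) \<le> real n * a}"
    have "measure_pmf.prob Jn (- G) = measure_pmf.prob (replicate_pmf n J) {\<omega>. (map fst \<omega>, map snd \<omega>) \<notin> G}"
      by (simp add: Jn_def vimage_def)
    also have "\<dots> \<le> measure_pmf.prob (replicate_pmf n J)
      ({\<omega>. real n * \<epsilon> \<le> \<bar>(\<Sum>i<n. case_prod d (\<omega> ! i)) - real n * \<Delta>\<bar>} \<union>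
       {\<omega>. real n * (a - I) \<le> \<bar>(\<Sum>i<n. \<iota> (\<omega> ! i)) - real n * I\<bar>})"
      by (rule measure_pmf.finite_measure_mono_AE)
        (auto intro!: AE_pmfI simp: G_def N_def case_prod_beta algebra_simps dest!: length_set_replicate_pmf)
    also have "\<dots> \<le> ?bad1 n + ?bad2 n"
      by (rule measure_Un_le) auto
    finally have \<eta>: "measure_pmf.prob Jn (- G) \<le> \<epsilon> / 2" using elim by simp
    have likelihood: "N zs cs \<and> \<alpha> * pmf Jn (zs, cs) \<le> pmf (replicate_pmf n P) zs * pmf (replicate_pmf n Q) cs"
      if G: "(zs, cs) \<in> G" and J: "(zs, cs) \<in> set_pmf Jn" for zs cs
    proof
      show "N zs cs" using G by (simp add: G_def)
      from J obtain \<omega> where \<omega>: "\<omega> \<in> set_pmf (replicate_pmf n J)" "zs = map fst \<omega>" "cs = map snd \<omega>"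
        by (auto simp: Jn_def)
      have len: "length \<omega> = n" using \<omega> by (auto dest: length_set_replicate_pmf)
      have inj: "inj (\<lambda>\<omega> :: ('z \<times> 'c) list. (map fst \<omega>, map snd \<omega>))"
        by (rule injI) (metis Pair_inject zip_map_fst_snd)
      have pos: "pmf J (\<omega> ! i) > 0" "pmf P (fst (\<omega> ! i)) > 0" "pmf Q (snd (\<omega> ! i)) > 0" if "i < n" for i
        using \<omega>(1) that by (auto simp: set_replicate_pmf P_def Q_def intro!: pmf_positive)
      have "pmf Jn (zs, cs) = (\<Prod>i<n. pmf J (\<omega> ! i))"
        unfolding Jn_def \<omega> using pmf_map_inj'[OF inj, of "replicate_pmf n J" \<omega>] len
        by (simp add: pmf_replicate_pmf)
      \<comment> \<open>On the support, 2 powr \<open>\<iota>\<close> is the density of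
        \<open>J\<close> relative to the product of its marginals; bounding the sum of
        \<open>\<iota>\<close> by n a then gives the domination with factor
        \<open>\<alpha>\<close>.\<close>
      also have "\<dots> = (\<Prod>i<n. 2 powr (\<iota> (\<omega> ! i)) * (pmf P (fst (\<omega> ! i)) * pmf Q (snd (\<omega> ! i))))"
      proof (rule prod.cong)
        fix i assume "i \<in> {..<n}"
        then show "pmf J (\<omega> ! i) = 2 powr (\<iota> (\<omega> ! i)) * (pmf P (fst (\<omega> ! i)) * pmf Q (snd (\<omega> ! i)))"
          using pos[of i] by (auto simp: \<iota>_def case_prod_beta)
      qed simp
      also have "\<dots> = 2 powr (\<Sum>i<n. \<iota> (\<omega> ! i)) * (pmf (replicate_pmf n P) zs * pmf (replicate_pmf n Q) cs)"
        using len by (simp add: prod.distrib powr_sum pmf_replicate_pmf \<omega>)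
      finally have "\<alpha> * pmf Jn (zs, cs) = 2 powr ((\<Sum>i<n. \<iota> (\<omega> ! i)) - real n * a) *
          (pmf (replicate_pmf n P) zs * pmf (replicate_pmf n Q) cs)"
        by (simp add: \<alpha>_def powr_diff powr_minus field_simps)
      also have "\<dots> \<le> 1 * (pmf (replicate_pmf n P) zs * pmf (replicate_pmf n Q) cs)"
        using G len by (intro mult_right_mono powr_le_1) (auto simp: G_def \<omega>)
      finally show "\<alpha> * pmf Jn (zs, cs) \<le> pmf (replicate_pmf n P) zs * pmf (replicate_pmf n Q) cs" by simp
    qed
    have "map_pmf fst Jn = replicate_pmf n P"
      by (simp add: Jn_def pmf.map_comp o_def P_def map_replicate_pmf)
    moreover have "finite (set_pmf Jn)" by (simp add: Jn_def)
    ultimately obtain C where C: "finite C" "card C \<le> k" "C \<subseteq> set_pmf (replicate_pmf n Q)"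
      "measure_pmf.prob (replicate_pmf n P) {zs. \<forall>cs\<in>C. \<not> N zs cs} \<le> \<epsilon> / 2 + (1 - \<alpha>) ^ k"
      using greedy_cover[of "replicate_pmf n P" "replicate_pmf n Q" Jn \<alpha> G "\<epsilon> / 2" N k] \<alpha> \<eta> likelihood
      by auto
    have "(1 - \<alpha>) ^ k \<le> exp (- \<alpha>) ^ k"
      using \<alpha> exp_ge_add_one_self[of "- \<alpha>"] by (intro power_mono) auto
    also have "\<dots> = exp (- (\<alpha> * real k))"
      by (simp flip: exp_of_nat_mult add: mult.commute)
    also have "\<alpha> * real k \<ge> \<alpha> * (2 powr (real n * R) - 1)"
      using \<alpha> unfolding k_def by (intro mult_left_mono) linarith+
    then have "exp (- (\<alpha> * real k)) \<le> exp (1 - 2 powr (real n * (R - a)))"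
      using \<alpha> by (simp add: \<alpha>_def algebra_simps flip: powr_add)
    finally have bound: "measure_pmf.prob (replicate_pmf n P) {zs. \<forall>cs\<in>C. \<not> N zs cs} \<le> \<epsilon>"
      using C elim by simp
    \<comment> \<open>With an empty codebook every word would be uncovered, with probability 1 >
      \<epsilon>.\<close>
    have "C \<noteq> {}"
      using bound \<epsilon> by auto
    moreover have "real (card C) \<le> 2 powr (real n * R)"
      using C(2) unfolding k_def by (simp add: le_nat_floor order_trans[OF _ of_nat_floor])
    ultimately show ?case
      using C bound unfolding N_def by (intro exI[of _ C]) (auto dest: length_set_replicate_pmf)
  qed
qed

section \<open>Bernoulli sources with Hamming distortion\<close>

text \<open>Nonnegativity of relative entropy between Bernoulli laws: summing x ln (y / x) \<le> y -
  x over the two letters makes the right-hand sides cancel.\<close>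

lemma h_b_gibbs:
  assumes "0 \<le> d" "d \<le> 1" "0 < q" "q < 1"
  shows "h_b d \<le> - d * log 2 q - (1 - d) * log 2 (1 - q)"
proof -
  have *: "x * ln (y / x) \<le> y - x" if "0 \<le> x" "0 < y" for x y :: real
  proof (cases "x = 0")
    case False
    then have "x * ln (y / x) \<le> x * (y / x - 1)"
      using that by (intro mult_left_mono ln_le_minus_one) auto
    then show ?thesis using False by (simp add: algebra_simps)
  qed (use that in auto)
  have **: "x * ln y - x * ln x \<le> y - x" if "0 \<le> x" "0 < y" for x y :: real
    using *[OF that] that by (cases "x = 0") (auto simp: ln_div algebra_simps)
  have "(d * ln q - d * ln d) + ((1 - d) * ln (1 - q) - (1 - d) * ln (1 - d)) \<le> 0"
    using **[of d q] **[of "1 - d" "1 - q"] assms by simp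
  then have "(- d * ln d - (1 - d) * ln (1 - d)) / ln 2 \<le> (- d * ln q - (1 - d) * ln (1 - q)) / ln 2"
    by (intro divide_right_mono) auto
  then show ?thesis
    by (simp add: h_b_def log_def diff_divide_distrib)
qed

text \<open>The cross entropy relative to q bounds \<open>h_b d\<close>, is affine in d with
  nonnegative slope for q \<le> 1/2, and equals \<open>h_b q\<close> at d = q.\<close>

lemma h_b_mono:
  assumes "0 \<le> d" "d \<le> q" "q \<le> 1 / 2"
  shows "h_b d \<le> h_b q"
proof (cases "q = 0")
  case False
  then have "h_b d \<le> - d * log 2 q - (1 - d) * log 2 (1 - q)"
    using assms by (intro h_b_gibbs) auto
  also have "\<dots> \<le> - q * log 2 q - (1 - q) * log 2 (1 - q)"
  proof -
    have "log 2 q \<le> log 2 (1 - q)" using assms False by simp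
    then have "(q - d) * log 2 q \<le> (q - d) * log 2 (1 - q)"
      using assms by (intro mult_left_mono) auto
    then show ?thesis by (simp add: algebra_simps)
  qed
  finally show ?thesis by (simp add: h_b_def)
qed (use assms in simp)

lemma avg_distortion_hamming_bounds:
  "0 \<le> avg_distortion hamming n xs ys" "avg_distortion hamming n xs ys \<le> 1"
proof -
  have "(\<Sum>i<n. hamming (xs ! i) (ys ! i)) \<le> (\<Sum>i<n. 1)"
    by (rule sum_mono) (simp add: hamming_def)
  then show "avg_distortion hamming n xs ys \<le> 1"
    by (cases "n = 0") (auto simp: avg_distortion_def field_simps)
  show "0 \<le> avg_distortion hamming n xs ys"
    unfolding avg_distortion_def by (intro mult_nonneg_nonneg sum_nonneg) (auto simp: hamming_def)
qed

section \<open>Binary symmetric test channel and quantizer\<close>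

lemma pmf_map_fst_bool: "pmf (map_pmf fst J) z = pmf J (z, False) + pmf J (z, True)"
proof -
  have fibre: "fst -` {z} = {(z, False), (z, True)}" by auto
  show ?thesis
    unfolding pmf_map fibre by (subst measure_measure_pmf_finite) auto
qed

text \<open>The joint law of (z, c) in which c is Bernoulli and z is c passed through a binary
  symmetric channel with crossover probability D; the parameter of c is chosen to make z
  Bernoulli with parameter q.\<close>

lemma bsc_test_channel:
  fixes D q :: real
  assumes "0 \<le> D" "D < q" "q \<le> 1 / 2"
  obtains J :: "(bool \<times> bool) pmf" where "map_pmf fst J = bernoulli_pmf q"
    "measure_pmf.expectation J (\<lambda>(z, c). hamming z c) = D"
    "measure_pmf.expectation J (\<lambda>(z, c). log 2 (pmf J (z, c) /
      (pmf (bernoulli_pmf q) z * pmf (map_pmf snd J) c))) = h_b q - h_b D"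
proof -
  define r where "r = (q - D) / (1 - 2 * D)"
  have r: "0 < r" "r < 1" using assms by (auto simp: r_def field_simps)
  have rD: "r * (1 - D) + (1 - r) * D = q"
  proof -
    have "r * (1 - 2 * D) = q - D" using assms by (simp add: r_def)
    then show ?thesis by (simp add: algebra_simps)
  qed
  define J where "J = map_pmf (\<lambda>(c, e). (c \<noteq> e, c)) (pair_pmf (bernoulli_pmf r) (bernoulli_pmf D))"
  have inj: "inj (\<lambda>(c :: bool, e). (c \<noteq> e, c))" by (auto simp: inj_def)
  have J: "pmf J (z, c) = pmf (bernoulli_pmf r) c * pmf (bernoulli_pmf D) (z \<noteq> c)" for z c
    unfolding J_def using pmf_map_inj'[OF inj, of "pair_pmf (bernoulli_pmf r) (bernoulli_pmf D)" "(c, z \<noteq> c)"]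
    by (cases z; cases c) (auto simp: pmf_pair)
  have E: "measure_pmf.expectation J f = (\<Sum>x\<in>UNIV. pmf J x * f x)" for f :: "_ \<Rightarrow> real"
    by (subst integral_measure_pmf[of UNIV]) auto
  have UN: "(UNIV :: (bool \<times> bool) set) = {(False, False), (False, True), (True, False), (True, True)}"
    by auto
  have snd: "map_pmf snd J = bernoulli_pmf r"
    by (simp add: J_def pmf.map_comp o_def case_prod_beta map_fst_pair_pmf)
  have fst: "map_pmf fst J = bernoulli_pmf q"
  proof (rule pmf_eqI)
    fix z :: bool
    have "pmf (map_pmf fst J) z = pmf J (z, False) + pmf J (z, True)"
      by (rule pmf_map_fst_bool)
    also have "\<dots> = pmf (bernoulli_pmf r) False * pmf (bernoulli_pmf D) z +
        pmf (bernoulli_pmf r) True * pmf (bernoulli_pmf D) (\<not> z)"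
      by (cases z) (simp_all add: J)
    also have "\<dots> = (if z then r * (1 - D) + (1 - r) * D else 1 - (r * (1 - D) + (1 - r) * D))"
      using r assms by (cases z) (simp_all add: algebra_simps)
    also have "\<dots> = pmf (bernoulli_pmf q) z"
      unfolding rD using assms by (cases z) simp_all
    finally show "pmf (map_pmf fst J) z = pmf (bernoulli_pmf q) z" .
  qed
  have "measure_pmf.expectation J (\<lambda>(z, c). hamming z c) = D"
    unfolding E UN using r assms by (simp add: J hamming_def algebra_simps)
  moreover have "measure_pmf.expectation J (\<lambda>(z, c). log 2 (pmf J (z, c) /
      (pmf (bernoulli_pmf q) z * pmf (map_pmf snd J) c))) = h_b q - h_b D"
  proof -
    \<comment> \<open>The codeword probability cancels in the ratio, leaving the channel probability
      over that of z. Pairs of mass 0, which occur for D = 0, contribute 0 on both sides.\<close>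
    have "pmf J (z, c) * log 2 (pmf J (z, c) / (pmf (bernoulli_pmf q) z * pmf (bernoulli_pmf r) c)) =
      pmf J (z, c) * (log 2 (pmf (bernoulli_pmf D) (z \<noteq> c)) - log 2 (pmf (bernoulli_pmf q) z))" for z c
    proof (cases "pmf J (z, c) = 0")
      case False
      moreover have "pmf (bernoulli_pmf r) c \<noteq> 0" "pmf (bernoulli_pmf q) z \<noteq> 0"
        using r assms by (cases c; cases z; simp)+
      ultimately show ?thesis
        by (auto simp: J log_divide pmf_positive_iff set_pmf_iff)
    qed simp
    then have "measure_pmf.expectation J (\<lambda>(z, c). log 2 (pmf J (z, c) /
      (pmf (bernoulli_pmf q) z * pmf (map_pmf snd J) c))) =
      (\<Sum>(z, c)\<in>UNIV. pmf J (z, c) * (log 2 (pmf (bernoulli_pmf D) (z \<noteq> c)) - log 2 (pmf (bernoulli_pmf q) z)))"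
      unfolding E fst snd by (auto intro!: sum.cong)
    also have "\<dots> = D * log 2 D + (1 - D) * log 2 (1 - D) -
      (r * (1 - D) + (1 - r) * D) * log 2 q - (1 - (r * (1 - D) + (1 - r) * D)) * log 2 (1 - q)"
      unfolding UN using r assms by (simp add: J algebra_simps)
    finally show ?thesis unfolding rD by (simp add: h_b_def)
  qed
  ultimately show ?thesis using that fst by blast
qed

text \<open>A word is sent to a codeword that covers it if there is one; the few uncovered words
  change the distortion by at most 1 each.\<close>

lemma bernoulli_quantizer:
  assumes "0 \<le> D" "D \<le> q" "q \<le> 1 / 2" "h_b q - h_b D < R" "0 < R" "0 < \<epsilon>"
  shows "\<forall>\<^sub>F n in sequentially. \<exists>\<phi> C. finite C \<and> real (card C) \<le> 2 powr (real n * R) \<and>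
    (\<forall>c\<in>C. length c = n) \<and> (\<forall>zs. \<phi> zs \<in> C) \<and>
    \<bar>measure_pmf.expectation (replicate_pmf n (bernoulli_pmf q)) (\<lambda>zs. avg_distortion hamming n zs (\<phi> zs)) - D\<bar> \<le> \<epsilon>"
proof (cases "D = q")
  \<comment> \<open>The test channel is available only for D < q. At D = q the
    all-\<open>False\<close> word alone has expected distortion q.\<close>
  case True
  show ?thesis
    using eventually_gt_at_top[of 0]
  proof eventually_elim
    case (elim n)
    have "measure_pmf.expectation (replicate_pmf n (bernoulli_pmf q))
        (\<lambda>zs. avg_distortion hamming n zs (replicate n False)) =
      (1 / real n) * measure_pmf.expectation (replicate_pmf n (bernoulli_pmf q))
        (\<lambda>zs. \<Sum>i<n. hamming (zs ! i) False)"
      by (simp add: avg_distortion_def)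
    also have "\<dots> = q"
      using elim assms by (subst expectation_iid_sum) (simp add: hamming_def)
    finally show ?case
      using assms True by (intro exI[of _ "\<lambda>_. replicate n False"] exI[of _ "{replicate n False}"])
        (auto simp: ge_one_powr_ge_zero)
  qed
next
  case False
  then have "D < q" using assms by simp
  obtain J :: "(bool \<times> bool) pmf" where J: "map_pmf fst J = bernoulli_pmf q"
    "measure_pmf.expectation J (\<lambda>(z, c). hamming z c) = D"
    "measure_pmf.expectation J (\<lambda>(z, c). log 2 (pmf J (z, c) /
      (pmf (bernoulli_pmf q) z * pmf (map_pmf snd J) c))) = h_b q - h_b D"
    using bsc_test_channel[OF \<open>0 \<le> D\<close> \<open>D < q\<close> \<open>q \<le> 1 / 2\<close>] by blast
  \<comment> \<open>The tolerance is spent twice, on the distortion of covered words and on the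
    probability of uncovered ones; the cap 1/2 keeps it below 1 as covering requires.\<close>
  define \<delta> where "\<delta> = min (\<epsilon> / 2) (1 / 2)"
  have \<delta>: "0 < \<delta>" "\<delta> < 1" "2 * \<delta> \<le> \<epsilon>" using assms by (auto simp: \<delta>_def)
  show ?thesis
    using lossy_covering[of J R \<delta> hamming, unfolded J, OF assms(4,5) \<delta>(1,2)] eventually_gt_at_top[of 0]
  proof eventually_elim
    case (elim n)
    then obtain C where C: "finite C" "C \<noteq> {}" "real (card C) \<le> 2 powr (real n * R)" "C \<subseteq> {cs. length cs = n}"
      "measure_pmf.prob (replicate_pmf n (bernoulli_pmf q))
      {zs. \<forall>cs\<in>C. \<not> \<bar>(\<Sum>i<n. hamming (zs ! i) (cs ! i)) - real n * D\<bar> \<le> real n * \<delta>} \<le> \<delta>" by blast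
    let ?B = "{zs. \<forall>cs\<in>C. \<not> \<bar>(\<Sum>i<n. hamming (zs ! i) (cs ! i)) - real n * D\<bar> \<le> real n * \<delta>}"
    have "\<exists>\<phi>. \<forall>zs. \<phi> zs \<in> C \<and> (zs \<notin> ?B \<longrightarrow>
      \<bar>(\<Sum>i<n. hamming (zs ! i) (\<phi> zs ! i)) - real n * D\<bar> \<le> real n * \<delta>)"
      by (rule choice) (use C(2) in auto)
    then obtain \<phi> where \<phi>: "\<And>zs. \<phi> zs \<in> C" "\<And>zs. zs \<notin> ?B \<Longrightarrow>
      \<bar>(\<Sum>i<n. hamming (zs ! i) (\<phi> zs ! i)) - real n * D\<bar> \<le> real n * \<delta>" by blast
    let ?E = "measure_pmf.expectation (replicate_pmf n (bernoulli_pmf q))"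
    have ptw: "\<bar>avg_distortion hamming n zs (\<phi> zs) - D\<bar> \<le> \<delta> + indicator ?B zs" for zs
    proof (cases "zs \<in> ?B")
      case True
      then show ?thesis
        using avg_distortion_hamming_bounds[of n zs "\<phi> zs"] assms \<delta> by (auto simp: abs_le_iff)
    next
      case False
      have "avg_distortion hamming n zs (\<phi> zs) - D = (1 / real n) * ((\<Sum>i<n. hamming (zs ! i) (\<phi> zs ! i)) - real n * D)"
        using \<open>0 < n\<close> by (simp add: avg_distortion_def field_simps)
      also have "\<bar>\<dots>\<bar> \<le> (1 / real n) * (real n * \<delta>)"
        unfolding abs_mult using \<phi>(2)[OF False] by (intro mult_mono) auto
      finally show ?thesis using False \<open>0 < n\<close> by simp
    qed
    have "?E (\<lambda>zs. avg_distortion hamming n zs (\<phi> zs)) - D = ?E (\<lambda>zs. avg_distortion hamming n zs (\<phi> zs) - D)"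
      by simp
    also have "\<bar>\<dots>\<bar> \<le> ?E (\<lambda>zs. \<bar>avg_distortion hamming n zs (\<phi> zs) - D\<bar>)"
      by (rule integral_abs_bound)
    also have "\<dots> \<le> ?E (\<lambda>zs. \<delta> + indicator ?B zs)"
      by (rule integral_mono) (use ptw in auto)
    also have "\<dots> = \<delta> + measure_pmf.prob (replicate_pmf n (bernoulli_pmf q)) ?B"
      by (subst Bochner_Integration.integral_add) simp_all
    also have "\<dots> \<le> \<epsilon>" using C(5) \<delta> by linarith
    finally show ?case
      using C \<phi>(1) by (intro exI[of _ \<phi>] exI[of _ C]) auto
  qed
qed

section \<open>Single-letter rate and its dual kernels\<close>

definition rate :: "real \<Rightarrow> real \<Rightarrow> real" where
  "rate q D = (h_b q - h_b D) * indicator {0..q} D"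

text \<open>The exponent \<^term>\<open>\<alpha> z + \<beta> * hamming z c\<close> is affine in the distortion, so its expectation
  depends on a code only through its expected distortion; since the slope is nonpositive, an upper
  bound on the distortion suffices. At D = 0 the optimal channel is degenerate and is replaced by
  one with a small crossover probability.\<close>

lemma dual_kernel:
  assumes "0 \<le> q" "q \<le> 1 / 2" "0 \<le> D" "0 < \<eta>"
  obtains v :: "bool \<Rightarrow> bool \<Rightarrow> real" and \<alpha> \<beta> where
    "\<And>c z. 0 \<le> v c z" "\<And>c. (\<Sum>z\<in>UNIV. v c z) = 1"
    "\<And>c z. z \<in> set_pmf (bernoulli_pmf q) \<Longrightarrow> 0 < v c z"
    "\<And>c z. z \<in> set_pmf (bernoulli_pmf q) \<Longrightarrow>
      log 2 (v c z / pmf (bernoulli_pmf q) z) = \<alpha> z + \<beta> * hamming z c"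
    "\<beta> \<le> 0" "rate q D - \<eta> \<le> measure_pmf.expectation (bernoulli_pmf q) \<alpha> + \<beta> * D"
proof (cases "D < q")
  \<comment> \<open>For D \<ge> q the rate is 0, so the source law itself serves as kernel, with
    zero exponent.\<close>
  case False
  have "rate q D = 0" using False by (auto simp: rate_def indicator_def)
  then show ?thesis
    using assms that[of "\<lambda>_. pmf (bernoulli_pmf q)" "\<lambda>_. 0" 0]
    by (auto simp: set_pmf_iff UNIV_bool pmf_positive_iff)
next
  case True
  have "\<exists>\<delta>>0. \<delta> \<le> 1 / 2 \<and> - h_b D - \<eta> \<le> (1 - D) * log 2 (1 - \<delta>) + D * log 2 \<delta>"
  proof (cases "D = 0")
    case True
    have "((\<lambda>\<delta>. log 2 (1 - \<delta>)) \<longlongrightarrow> log 2 (1 - 0)) (at_right (0 :: real))"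
      by (intro tendsto_intros) auto
    then have "\<forall>\<^sub>F \<delta> in at_right (0 :: real). - \<eta> < log 2 (1 - \<delta>)"
      using assms by (intro order_tendstoD(1)) auto
    moreover have "\<forall>\<^sub>F \<delta> in at_right (0 :: real). \<delta> \<in> {0<..<1/2}"
      by (rule eventually_at_right_real) simp
    ultimately have "\<forall>\<^sub>F \<delta> in at_right (0 :: real). - \<eta> < log 2 (1 - \<delta>) \<and> \<delta> \<in> {0<..<1/2}"
      by (rule eventually_conj)
    then obtain \<delta> :: real where "- \<eta> < log 2 (1 - \<delta>) \<and> \<delta> \<in> {0<..<1/2}"
      using eventually_happens' trivial_limit_at_right_real by blast
    then show ?thesis using True by (intro exI[of _ \<delta>]) (auto simp: h_b_def)
  next
    case False
    then show ?thesis
      using True assms by (intro exI[of _ D]) (auto simp: h_b_def)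
  qed
  then obtain \<delta> where \<delta>: "0 < \<delta>" "\<delta> \<le> 1 / 2"
    "- h_b D - \<eta> \<le> (1 - D) * log 2 (1 - \<delta>) + D * log 2 \<delta>" by blast
  \<comment> \<open>The channel has only two values, one for agreement and one for disagreement, so
    its logarithm is affine in the Hamming distortion; \<delta> \<le> 1/2 makes the slope
    nonpositive.\<close>
  define v where "v c z = (if c = z then 1 - \<delta> else \<delta>)" for c z :: bool
  define \<alpha> where "\<alpha> z = log 2 (1 - \<delta>) - log 2 (pmf (bernoulli_pmf q) z)" for z
  define \<beta> where "\<beta> = log 2 \<delta> - log 2 (1 - \<delta>)"
  have "measure_pmf.expectation (bernoulli_pmf q) \<alpha> = log 2 (1 - \<delta>) + h_b q"
    using assms by (simp add: \<alpha>_def h_b_def algebra_simps)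
  moreover have "rate q D = h_b q - h_b D"
    using True assms by (simp add: rate_def)
  ultimately have "rate q D - \<eta> \<le> measure_pmf.expectation (bernoulli_pmf q) \<alpha> + \<beta> * D"
    using \<delta>(3) by (simp add: \<beta>_def algebra_simps)
  moreover have "log 2 (v c z / pmf (bernoulli_pmf q) z) = \<alpha> z + \<beta> * hamming z c"
    if "z \<in> set_pmf (bernoulli_pmf q)" for c z
    using that \<delta> by (auto simp: v_def \<alpha>_def \<beta>_def hamming_def log_divide set_pmf_iff)
  moreover have "\<beta> \<le> 0" using \<delta> by (simp add: \<beta>_def)
  moreover have "(\<Sum>z\<in>UNIV. v c z) = 1" for c by (cases c) (auto simp: v_def UNIV_bool)
  moreover have "0 \<le> v c z" "0 < v c z" for c z using \<delta> by (auto simp: v_def)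
  ultimately show ?thesis using that by blast
qed

section \<open>The source with side information\<close>

text \<open>Independent coordinates: a fair bit y, the noises z1 and z2 from Y to X1 and to X2, and
  the noise w from X1 to S.\<close>

definition source :: "real \<Rightarrow> real \<Rightarrow> real \<Rightarrow> (bool \<times> bool \<times> bool \<times> bool) pmf" where
  "source p p2 p3 = map_pmf (\<lambda>((y, z1, z2), w). ((y \<noteq> z1) \<noteq> w, y \<noteq> z1, y \<noteq> z2, y))
    (pair_pmf (pair_pmf (bernoulli_pmf (1 / 2)) (pair_pmf (bernoulli_pmf p2) (bernoulli_pmf p3)))
      (bernoulli_pmf p))"

lemma pmf_source:
  "pmf (source p p2 p3) (s, x1, x2, y) =
    1 / 2 * pmf (bernoulli_pmf p2) (x1 \<noteq> y) * pmf (bernoulli_pmf p3) (x2 \<noteq> y) * pmf (bernoulli_pmf p) (s \<noteq> x1)"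
proof -
  let ?T = "\<lambda>((y, z1, z2), w). ((y \<noteq> z1) \<noteq> w, y \<noteq> z1, y \<noteq> z2, y) :: bool \<times> bool \<times> bool \<times> bool"
  have inj: "inj ?T" by (auto simp: inj_def)
  have eq: "(s, x1, x2, y) = ?T ((y, x1 \<noteq> y, x2 \<noteq> y), s \<noteq> x1)" by auto
  show ?thesis
    unfolding source_def by (subst eq, subst pmf_map_inj'[OF inj]) (simp add: pmf_pair)
qed

lemma DSBS_prob:
  assumes "DSBS M q A B"
  shows "\<P>(\<omega> in M. A \<omega> = a \<and> B \<omega> = b) = (if a = b then (1 - q) / 2 else q / 2)"
  using assms by (cases a; cases b) (auto simp: DSBS_def)

lemma (in prob_space) DSBS_marginal:
  assumes "DSBS M q A B" and [measurable]: "A \<in> M \<rightarrow>\<^sub>M count_space UNIV" "B \<in> M \<rightarrow>\<^sub>M count_space UNIV"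
  shows "\<P>(\<omega> in M. A \<omega> = a) = 1 / 2" "\<P>(\<omega> in M. B \<omega> = b) = 1 / 2"
proof -
  have "\<P>(\<omega> in M. A \<omega> = a) = \<P>(\<omega> in M. A \<omega> = a \<and> B \<omega> = True) + \<P>(\<omega> in M. A \<omega> = a \<and> B \<omega> = False)"
    by (subst finite_measure_Union[symmetric]) (auto intro!: arg_cong[where f = "measure M"])
  then show "\<P>(\<omega> in M. A \<omega> = a) = 1 / 2"
    unfolding DSBS_prob[OF assms(1)] by (auto simp: field_simps)
  have "\<P>(\<omega> in M. B \<omega> = b) = \<P>(\<omega> in M. A \<omega> = True \<and> B \<omega> = b) + \<P>(\<omega> in M. A \<omega> = False \<and> B \<omega> = b)"
    by (subst finite_measure_Union[symmetric]) (auto intro!: arg_cong[where f = "measure M"])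
  then show "\<P>(\<omega> in M. B \<omega> = b) = 1 / 2"
    unfolding DSBS_prob[OF assms(1)] by (auto simp: field_simps)
qed

text \<open>The two Markov chains factor the joint law into the three pairwise laws, all with
  uniform marginals, and these determine it.\<close>

lemma pmf_of_rv_eq_source:
  fixes M :: "'w measure" and S X1 X2 Y :: "'w \<Rightarrow> bool"
  assumes "prob_space M"
    and "S \<in> M \<rightarrow>\<^sub>M count_space UNIV" "X1 \<in> M \<rightarrow>\<^sub>M count_space UNIV"
    and "X2 \<in> M \<rightarrow>\<^sub>M count_space UNIV" "Y \<in> M \<rightarrow>\<^sub>M count_space UNIV"
    and "0 \<le> p" "p \<le> 1" "0 \<le> p2" "p2 \<le> 1" "0 \<le> p3" "p3 \<le> 1"
    and "DSBS M p S X1" "DSBS M p2 X1 Y" "DSBS M p3 X2 Y"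
    and "markov_chain M S X1 (\<lambda>\<omega>. (X2 \<omega>, Y \<omega>))"
    and "markov_chain M X1 Y X2"
  shows "pmf_of_rv M (\<lambda>\<omega>. (S \<omega>, X1 \<omega>, X2 \<omega>, Y \<omega>)) = source p p2 p3"
proof -
  interpret prob_space M by fact
  have prob: "\<P>(\<omega> in M. (S \<omega>, X1 \<omega>, X2 \<omega>, Y \<omega>) = t) = pmf (source p p2 p3) t" for t
  proof -
    obtain s x1 x2 y where t: "t = (s, x1, x2, y)" by (cases t)
    have "\<P>(\<omega> in M. X1 \<omega> = x1 \<and> X2 \<omega> = x2 \<bar> Y \<omega> = y) =
      \<P>(\<omega> in M. X1 \<omega> = x1 \<bar> Y \<omega> = y) * \<P>(\<omega> in M. X2 \<omega> = x2 \<bar> Y \<omega> = y)"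
      using assms(16) by (auto simp: markov_chain_def)
    \<comment> \<open>Denominators of the conditional probabilities are cleared; the factor 2 is 1 /
      P(Y = y).\<close>
    then have 1: "\<P>(\<omega> in M. (X1 \<omega> = x1 \<and> X2 \<omega> = x2) \<and> Y \<omega> = y) =
        2 * \<P>(\<omega> in M. X1 \<omega> = x1 \<and> Y \<omega> = y) * \<P>(\<omega> in M. X2 \<omega> = x2 \<and> Y \<omega> = y)"
      unfolding cond_prob_def DSBS_marginal(2)[OF assms(13,3,5)] by simp
    have "\<P>(\<omega> in M. S \<omega> = s \<and> (X2 \<omega>, Y \<omega>) = (x2, y) \<bar> X1 \<omega> = x1) =
      \<P>(\<omega> in M. S \<omega> = s \<bar> X1 \<omega> = x1) * \<P>(\<omega> in M. (X2 \<omega>, Y \<omega>) = (x2, y) \<bar> X1 \<omega> = x1)"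
      using assms(15) unfolding markov_chain_def by blast
    then have 2: "\<P>(\<omega> in M. (S \<omega> = s \<and> (X2 \<omega>, Y \<omega>) = (x2, y)) \<and> X1 \<omega> = x1) =
        2 * \<P>(\<omega> in M. S \<omega> = s \<and> X1 \<omega> = x1) * \<P>(\<omega> in M. (X2 \<omega>, Y \<omega>) = (x2, y) \<and> X1 \<omega> = x1)"
      unfolding cond_prob_def DSBS_marginal(2)[OF assms(12,2,3)] by simp
    have "\<P>(\<omega> in M. (S \<omega>, X1 \<omega>, X2 \<omega>, Y \<omega>) = t) = \<P>(\<omega> in M. (S \<omega> = s \<and> (X2 \<omega>, Y \<omega>) = (x2, y)) \<and> X1 \<omega> = x1)"
      by (rule arg_cong[where f = "measure M"]) (auto simp: t)
    also note 2
    also have "\<P>(\<omega> in M. (X2 \<omega>, Y \<omega>) = (x2, y) \<and> X1 \<omega> = x1) = \<P>(\<omega> in M. (X1 \<omega> = x1 \<and> X2 \<omega> = x2) \<and> Y \<omega> = y)"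
      by (rule arg_cong[where f = "measure M"]) auto
    also note 1
    also have "2 * \<P>(\<omega> in M. S \<omega> = s \<and> X1 \<omega> = x1) *
        (2 * \<P>(\<omega> in M. X1 \<omega> = x1 \<and> Y \<omega> = y) * \<P>(\<omega> in M. X2 \<omega> = x2 \<and> Y \<omega> = y)) =
      pmf (source p p2 p3) t"
      unfolding t pmf_source DSBS_prob[OF assms(12)] DSBS_prob[OF assms(13)] DSBS_prob[OF assms(14)]
      using assms(6-11) by (cases s; cases x1; cases x2; cases y) (simp_all add: field_simps)
    finally show ?thesis .
  qed
  show ?thesis
    unfolding pmf_of_rv_def prob
    by (intro pmf_eqI pmf_embed_pmf) (auto simp: nn_integral_pmf_eq_1)
qed

section \<open>Codes in noise coordinates\<close>

definition xor_list :: "bool list \<Rightarrow> bool list \<Rightarrow> bool list" where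
  "xor_list xs ys = map2 (\<noteq>) xs ys"

lemma length_xor_list [simp]: "length (xor_list xs ys) = min (length xs) (length ys)"
  by (simp add: xor_list_def)

lemma xor_list_xor_list [simp]: "length xs = length ys \<Longrightarrow> xor_list xs (xor_list xs ys) = ys"
  by (rule nth_equalityI) (auto simp: xor_list_def)

text \<open>Hamming distortion is invariant under adding the same word to both arguments, so the
  side information can be moved from the source to the reconstruction.\<close>

lemma avg_distortion_xor_list:
  assumes "length ys = n" "length zs = n" "length cs = n"
  shows "avg_distortion hamming n (xor_list ys zs) cs = avg_distortion hamming n zs (xor_list ys cs)"
  unfolding avg_distortion_def using assms
  by (intro arg_cong2[where f = "(*)"] sum.cong) (auto simp: xor_list_def hamming_def)

text \<open>Change of variables to the independent coordinates of \<open>source\<close>. The noise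
  \<open>ws\<close> is innermost because neither encoder nor decoder sees it.\<close>

lemma code_expectation_source:
  "code_expectation (source p p2 p3) n f g c =
    measure_pmf.expectation (replicate_pmf n (bernoulli_pmf (1 / 2))) (\<lambda>ys.
    measure_pmf.expectation (replicate_pmf n (pair_pmf (bernoulli_pmf p2) (bernoulli_pmf p3))) (\<lambda>zs.
    measure_pmf.expectation (replicate_pmf n (bernoulli_pmf p)) (\<lambda>ws.
      let x1 = xor_list ys (map fst zs); x2 = xor_list ys (map snd zs); (x1h, x2h, sh) = g (f x1 x2 ys) ys
      in c (xor_list x1 ws) x1 x2 x1h x2h sh)))"
proof -
  define h where "h ys zs ws = (let x1 = xor_list ys (map fst zs); x2 = xor_list ys (map snd zs);
      (x1h, x2h, sh) = g (f x1 x2 ys) ys in c (xor_list x1 ws) x1 x2 x1h x2h sh)" for ys zs ws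
  let ?T = "\<lambda>((y, z1, z2), w). ((y \<noteq> z1) \<noteq> w, y \<noteq> z1, y \<noteq> z2, y) :: bool \<times> bool \<times> bool \<times> bool"
  let ?B = "bernoulli_pmf (1 / 2)" and ?Z = "pair_pmf (bernoulli_pmf p2) (bernoulli_pmf p3)"
  have comps: "map (\<lambda>(s, x1, x2, y). s) (map ?T \<omega>) =
      xor_list (xor_list (map fst (map fst \<omega>)) (map fst (map snd (map fst \<omega>)))) (map snd \<omega>)"
    "map (\<lambda>(s, x1, x2, y). x1) (map ?T \<omega>) = xor_list (map fst (map fst \<omega>)) (map fst (map snd (map fst \<omega>)))"
    "map (\<lambda>(s, x1, x2, y). x2) (map ?T \<omega>) = xor_list (map fst (map fst \<omega>)) (map snd (map snd (map fst \<omega>)))"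
    "map (\<lambda>(s, x1, x2, y). y) (map ?T \<omega>) = map fst (map fst \<omega>)" for \<omega>
    by (induction \<omega>) (auto simp: xor_list_def)
  have "code_expectation (source p p2 p3) n f g c =
    measure_pmf.expectation (replicate_pmf n (pair_pmf (pair_pmf ?B ?Z) (bernoulli_pmf p)))
      (\<lambda>\<omega>. h (map fst (map fst \<omega>)) (map snd (map fst \<omega>)) (map snd \<omega>))"
    unfolding code_expectation_def source_def map_replicate_pmf[symmetric] integral_map_pmf comps
    by (simp only: h_def Let_def)
  also have "\<dots> = measure_pmf.expectation (replicate_pmf n (pair_pmf ?B ?Z)) (\<lambda>us.
      measure_pmf.expectation (replicate_pmf n (bernoulli_pmf p)) (\<lambda>ws. h (map fst us) (map snd us) ws))"
    by (rule expectation_replicate_pair_pmf[where h = "\<lambda>us ws. h (map fst us) (map snd us) ws"])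
  also have "\<dots> = measure_pmf.expectation (replicate_pmf n ?B) (\<lambda>ys. measure_pmf.expectation (replicate_pmf n ?Z) (\<lambda>zs.
      measure_pmf.expectation (replicate_pmf n (bernoulli_pmf p)) (\<lambda>ws. h ys zs ws)))"
    by (rule expectation_replicate_pair_pmf)
  finally show ?thesis unfolding h_def .
qed

text \<open>A letter distortion d, which is 0 or 1, is flipped with probability p and so has mean p
  (1 - d) + (1 - p) d.\<close>

lemma expectation_noisy_distortion:
  assumes "0 \<le> p" "p \<le> 1" "length xs = n" "n > 0"
  shows "measure_pmf.expectation (replicate_pmf n (bernoulli_pmf p))
      (\<lambda>ws. avg_distortion hamming n (xor_list xs ws) cs) = p + (1 - 2 * p) * avg_distortion hamming n xs cs"
proof -
  let ?E = "measure_pmf.expectation (replicate_pmf n (bernoulli_pmf p))"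
  have "?E (\<lambda>ws. avg_distortion hamming n (xor_list xs ws) cs) =
      ?E (\<lambda>ws. (1 / real n) * (\<Sum>i<n. hamming (xs ! i \<noteq> ws ! i) (cs ! i)))"
    unfolding avg_distortion_def
    by (intro integral_cong_AE AE_pmfI)
      (use assms in \<open>auto simp: xor_list_def dest!: length_set_replicate_pmf intro!: sum.cong\<close>)
  also have "\<dots> = (1 / real n) * (\<Sum>i<n. p + (1 - 2 * p) * hamming (xs ! i) (cs ! i))"
    unfolding integral_mult_right_zero expectation_replicate_pmf_sum[where g = "\<lambda>i w. hamming (xs ! i \<noteq> w) (cs ! i)"]
    using assms by (intro arg_cong2[where f = "(*)"] sum.cong) (auto simp: hamming_def)
  also have "\<dots> = (1 / real n) * (real n * p + (1 - 2 * p) * (\<Sum>i<n. hamming (xs ! i) (cs ! i)))"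
    by (simp add: sum.distrib flip: sum_distrib_left)
  also have "\<dots> = p + (1 - 2 * p) * avg_distortion hamming n xs cs"
    using assms by (simp add: avg_distortion_def field_simps)
  finally show ?thesis .
qed

text \<open>The side information is the outer variable, so that a bound can be proved for each fixed
  \<open>ys\<close> and then averaged.\<close>

definition noise_expectation ::
    "nat \<Rightarrow> real \<Rightarrow> real \<Rightarrow> (bool list \<Rightarrow> (bool \<times> bool) list \<Rightarrow> real) \<Rightarrow> real" where
  "noise_expectation n p2 p3 h =
    measure_pmf.expectation (replicate_pmf n (bernoulli_pmf (1 / 2))) (\<lambda>ys.
    measure_pmf.expectation (replicate_pmf n (pair_pmf (bernoulli_pmf p2) (bernoulli_pmf p3))) (\<lambda>zs. h ys zs))"

definition message :: "(bool, bool, bool) encoder \<Rightarrow> bool list \<Rightarrow> (bool \<times> bool) list \<Rightarrow> nat" where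
  "message f ys zs = f (xor_list ys (map fst zs)) (xor_list ys (map snd zs)) ys"

lemma noise_expectation_cong:
  assumes "\<And>ys zs. length ys = n \<Longrightarrow> length zs = n \<Longrightarrow> h ys zs = h' ys zs"
  shows "noise_expectation n p2 p3 h = noise_expectation n p2 p3 h'"
  unfolding noise_expectation_def
  by (intro integral_cong_AE AE_pmfI assms) (auto dest!: length_set_replicate_pmf)

text \<open>In noise coordinates the reconstruction of S also acts as a reconstruction of the first
  noise sequence, up to the affine map from averaging out the noise between X1 and S.\<close>

lemma code_distortions:
  assumes code: "is_code n R f g" and "n > 0" and p: "0 \<le> p" "p \<le> 1"
  shows "code_expectation (source p p2 p3) n f g (\<lambda>s x1 x2 x1h x2h sh. avg_distortion hamming n x1 x1h) =
      noise_expectation n p2 p3 (\<lambda>ys zs. avg_distortion hamming n (map fst zs)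
        (xor_list ys (fst (g (message f ys zs) ys))))" (is ?t1)
    and "code_expectation (source p p2 p3) n f g (\<lambda>s x1 x2 x1h x2h sh. avg_distortion hamming n x2 x2h) =
      noise_expectation n p2 p3 (\<lambda>ys zs. avg_distortion hamming n (map snd zs)
        (xor_list ys (fst (snd (g (message f ys zs) ys)))))" (is ?t2)
    and "code_expectation (source p p2 p3) n f g (\<lambda>s x1 x2 x1h x2h sh. avg_distortion hamming n s sh) =
      p + (1 - 2 * p) * noise_expectation n p2 p3 (\<lambda>ys zs. avg_distortion hamming n (map fst zs)
        (xor_list ys (snd (snd (g (message f ys zs) ys)))))" (is ?t3)
proof -
  have len: "length (fst (g (message f ys zs) ys)) = n" "length (fst (snd (g (message f ys zs) ys))) = n"
    "length (snd (snd (g (message f ys zs) ys))) = n" if "length ys = n" "length zs = n" for ys zs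
    using code that by (auto simp: is_code_def message_def case_prod_beta)
  note unfold = code_expectation_source Let_def case_prod_beta noise_expectation_def[symmetric] message_def[symmetric]
  show ?t1 ?t2
    unfolding unfold using len by (auto intro!: noise_expectation_cong avg_distortion_xor_list)
  have "code_expectation (source p p2 p3) n f g (\<lambda>s x1 x2 x1h x2h sh. avg_distortion hamming n s sh) =
      noise_expectation n p2 p3 (\<lambda>ys zs. p + (1 - 2 * p) * avg_distortion hamming n (map fst zs)
        (xor_list ys (snd (snd (g (message f ys zs) ys)))))"
    unfolding unfold using len p \<open>n > 0\<close>
    by (auto intro!: noise_expectation_cong simp: expectation_noisy_distortion avg_distortion_xor_list)
  then show ?t3 by (simp add: noise_expectation_def)
qed

section \<open>Message count and the rate bound at fixed block length\<close>

lemma finite_messages [simp]: "finite (messages n R)"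
  and card_messages: "card (messages n R) = nat \<lfloor>2 powr (real n * R)\<rfloor>"
proof -
  have "messages n R = {1..nat \<lfloor>2 powr (real n * R)\<rfloor>}"
    by (auto simp: messages_def le_nat_floor) (meson le_nat_floor of_nat_floor of_nat_le_iff order_trans powr_ge_zero)
  then show "finite (messages n R)" "card (messages n R) = nat \<lfloor>2 powr (real n * R)\<rfloor>" by auto
qed

text \<open>For fixed side information the pair of noises is a product source. The product kernel of
  \<open>v\<close> and \<open>w\<close> makes the log-likelihood ratio a sum of two affine functions
  of the distortions, so a single count of messages bounds both rates together.\<close>

lemma dual_bound:
  fixes \<phi> :: "(bool \<times> bool) list \<Rightarrow> nat" and a b :: "nat \<Rightarrow> bool list"
  assumes "finite K" "real (card K) \<le> 2 powr (real n * R)" "n > 0"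
    and \<phi>: "\<And>zs. length zs = n \<Longrightarrow> \<phi> zs \<in> K"
    and v: "\<And>c z. 0 \<le> v c z" "\<And>c. (\<Sum>z\<in>UNIV. v c z) = 1"
      "\<And>c z. z \<in> set_pmf p \<Longrightarrow> 0 < v c z"
      "\<And>c z. z \<in> set_pmf p \<Longrightarrow> log 2 (v c z / pmf p z) = \<alpha> z + \<beta> * hamming z c"
    and w: "\<And>c z. 0 \<le> w c z" "\<And>c. (\<Sum>z\<in>UNIV. w c z) = 1"
      "\<And>c z. z \<in> set_pmf q \<Longrightarrow> 0 < w c z"
      "\<And>c z. z \<in> set_pmf q \<Longrightarrow> log 2 (w c z / pmf q z) = \<gamma> z + \<delta> * hamming z c"
  defines "E \<equiv> measure_pmf.expectation (replicate_pmf n (pair_pmf p q))"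
  shows "measure_pmf.expectation p \<alpha> + measure_pmf.expectation q \<gamma> +
    \<beta> * E (\<lambda>zs. avg_distortion hamming n (map fst zs) (a (\<phi> zs))) +
    \<delta> * E (\<lambda>zs. avg_distortion hamming n (map snd zs) (b (\<phi> zs))) \<le> R"
proof -
  let ?u = "\<lambda>(c :: bool \<times> bool) (z :: bool \<times> bool). v (fst c) (fst z) * w (snd c) (snd z)"
  let ?c = "\<lambda>m i. (a m ! i, b m ! i)"
  obtain zs0 :: "(bool \<times> bool) list" where "length zs0 = n"
    using Ex_list_of_length by blast
  then have K: "real (card K) > 0"
    using \<phi> \<open>finite K\<close> by (fastforce simp: card_gt_0_iff)
  have sum_u: "(\<Sum>z\<in>UNIV. ?u c z) = 1" for c
  proof -
    have "(\<Sum>z\<in>UNIV. ?u c z) = (\<Sum>x\<in>UNIV. v (fst c) x) * (\<Sum>y\<in>UNIV. w (snd c) y)"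
      by (simp add: sum_product sum.cartesian_product UNIV_Times_UNIV[symmetric] case_prod_beta del: UNIV_Times_UNIV)
    then show ?thesis by (simp add: v w)
  qed
  have "E (\<lambda>zs. \<Sum>i<n. ln (?u (?c (\<phi> zs) i) (zs ! i) / pmf (pair_pmf p q) (zs ! i))) \<le> ln (real (card K))"
    unfolding E_def
    by (rule expected_log_likelihood_ratio_le[where v = ?u and c = ?c])
      (use assms(1) \<phi> v w sum_u in auto)
  also have "\<dots> \<le> ln (2 powr (real n * R))"
    using K assms(2) by (subst ln_le_cancel_iff) auto
  also have "\<dots> = ln 2 * (real n * R)" by (simp add: ln_powr)
  also have "E (\<lambda>zs. \<Sum>i<n. ln (?u (?c (\<phi> zs) i) (zs ! i) / pmf (pair_pmf p q) (zs ! i))) =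
    E (\<lambda>zs. ln 2 * ((\<Sum>i<n. \<alpha> (fst (zs ! i)) + \<gamma> (snd (zs ! i))) +
      real n * (\<beta> * avg_distortion hamming n (map fst zs) (a (\<phi> zs)) +
      \<delta> * avg_distortion hamming n (map snd zs) (b (\<phi> zs)))))"
    unfolding E_def
  proof (intro integral_cong_AE AE_pmfI)
    fix zs assume zs: "zs \<in> set_pmf (replicate_pmf n (pair_pmf p q))"
    then have len: "length zs = n" by (rule length_set_replicate_pmf)
    have "ln (?u (?c (\<phi> zs) i) (zs ! i) / pmf (pair_pmf p q) (zs ! i)) =
        ln 2 * ((\<alpha> (fst (zs ! i)) + \<gamma> (snd (zs ! i))) +
          (\<beta> * hamming (map fst zs ! i) (a (\<phi> zs) ! i) + \<delta> * hamming (map snd zs ! i) (b (\<phi> zs) ! i)))"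
      if "i < n" for i
    proof -
      obtain x y where xy: "zs ! i = (x, y)" by fastforce
      have "zs ! i \<in> set_pmf (pair_pmf p q)"
        using zs that by (auto simp: set_replicate_pmf simp del: set_pair_pmf)
      then have mem: "x \<in> set_pmf p" "y \<in> set_pmf q"
        by (auto simp: xy)
      have "ln (?u (?c (\<phi> zs) i) (zs ! i) / pmf (pair_pmf p q) (zs ! i)) =
        ln ((v (a (\<phi> zs) ! i) x / pmf p x) * (w (b (\<phi> zs) ! i) y / pmf q y))"
        by (simp add: xy pmf_pair)
      also have "\<dots> = ln (v (a (\<phi> zs) ! i) x / pmf p x) + ln (w (b (\<phi> zs) ! i) y / pmf q y)"
        using v(3)[OF mem(1), of "a (\<phi> zs) ! i"] w(3)[OF mem(2), of "b (\<phi> zs) ! i"] mem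
        by (intro ln_mult_pos divide_pos_pos pmf_positive)
      also have "\<dots> = ln 2 * (log 2 (v (a (\<phi> zs) ! i) x / pmf p x) + log 2 (w (b (\<phi> zs) ! i) y / pmf q y))"
        by (simp add: log_def field_simps)
      finally show ?thesis
        using that len by (simp add: v(4)[OF mem(1)] w(4)[OF mem(2)] xy)
    qed
    then have "(\<Sum>i<n. ln (?u (?c (\<phi> zs) i) (zs ! i) / pmf (pair_pmf p q) (zs ! i))) =
      (\<Sum>i<n. ln 2 * ((\<alpha> (fst (zs ! i)) + \<gamma> (snd (zs ! i))) +
          (\<beta> * hamming (map fst zs ! i) (a (\<phi> zs) ! i) + \<delta> * hamming (map snd zs ! i) (b (\<phi> zs) ! i))))"
      by (intro sum.cong) auto
    also have "\<dots> = ln 2 * ((\<Sum>i<n. \<alpha> (fst (zs ! i)) + \<gamma> (snd (zs ! i))) +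
      (\<beta> * (\<Sum>i<n. hamming (map fst zs ! i) (a (\<phi> zs) ! i)) + \<delta> * (\<Sum>i<n. hamming (map snd zs ! i) (b (\<phi> zs) ! i))))"
      by (simp add: sum_distrib_left sum.distrib distrib_left)
    also have "(\<Sum>i<n. hamming (map fst zs ! i) (a (\<phi> zs) ! i)) = real n * avg_distortion hamming n (map fst zs) (a (\<phi> zs))"
      using \<open>n > 0\<close> by (simp add: avg_distortion_def)
    also have "(\<Sum>i<n. hamming (map snd zs ! i) (b (\<phi> zs) ! i)) = real n * avg_distortion hamming n (map snd zs) (b (\<phi> zs))"
      using \<open>n > 0\<close> by (simp add: avg_distortion_def)
    finally show "(\<Sum>i<n. ln (?u (?c (\<phi> zs) i) (zs ! i) / pmf (pair_pmf p q) (zs ! i))) =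
      ln 2 * ((\<Sum>i<n. \<alpha> (fst (zs ! i)) + \<gamma> (snd (zs ! i))) +
      real n * (\<beta> * avg_distortion hamming n (map fst zs) (a (\<phi> zs)) +
      \<delta> * avg_distortion hamming n (map snd zs) (b (\<phi> zs))))"
      by (simp add: algebra_simps)
  qed auto
  also have "\<dots> = ln 2 * (real n * (measure_pmf.expectation p \<alpha> + measure_pmf.expectation q \<gamma> +
    \<beta> * E (\<lambda>zs. avg_distortion hamming n (map fst zs) (a (\<phi> zs))) +
    \<delta> * E (\<lambda>zs. avg_distortion hamming n (map snd zs) (b (\<phi> zs)))))"
    unfolding E_def
    by (simp add: expectation_iid_sum[where g = "\<lambda>z. \<alpha> (fst z) + \<gamma> (snd z)"] algebra_simps)
  finally show ?thesis
    using \<open>n > 0\<close> by simp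
qed

section \<open>The rate-distortion function\<close>

text \<open>The bound for each block length is linear in the distortions, so it passes directly to
  their limits.\<close>

lemma converse:
  assumes p: "0 \<le> p" "p < 1 / 2" and q: "0 \<le> p2" "p2 \<le> 1 / 2" "0 \<le> p3" "p3 \<le> 1 / 2"
    and D: "0 \<le> D1" "0 \<le> D2" "p \<le> Ds"
    and ach: "achievable (source p p2 p3) (hamming :: bool \<Rightarrow> bool \<Rightarrow> real)
      (hamming :: bool \<Rightarrow> bool \<Rightarrow> real) (hamming :: bool \<Rightarrow> bool \<Rightarrow> real) R D1 D2 Ds"
  shows "rate p2 (min D1 ((Ds - p) / (1 - 2 * p))) + rate p3 D2 \<le> R"
proof -
  define D where "D = min D1 ((Ds - p) / (1 - 2 * p))"
  have "0 \<le> D" using D p by (simp add: D_def)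
  obtain f g l1 l2 ls where code: "\<forall>\<^sub>F n in sequentially. is_code n R (f n) (g n)"
    and lim1: "(\<lambda>n. code_expectation (source p p2 p3) n (f n) (g n)
      (\<lambda>s x1 x2 x1h x2h sh. avg_distortion hamming n x1 x1h)) \<longlonglongrightarrow> l1" and l1: "l1 \<le> D1"
    and lim2: "(\<lambda>n. code_expectation (source p p2 p3) n (f n) (g n)
      (\<lambda>s x1 x2 x1h x2h sh. avg_distortion hamming n x2 x2h)) \<longlonglongrightarrow> l2" and l2: "l2 \<le> D2"
    and lims: "(\<lambda>n. code_expectation (source p p2 p3) n (f n) (g n)
      (\<lambda>s x1 x2 x1h x2h sh. avg_distortion hamming n s sh)) \<longlonglongrightarrow> ls" and ls: "ls \<le> Ds"
    using ach unfolding achievable_def by blast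
  define \<Delta> where "\<Delta> n sel = noise_expectation n p2 p3 (\<lambda>ys zs. avg_distortion hamming n (map fst zs)
        (xor_list ys (sel (g n (message (f n) ys zs) ys))))"
    for n and sel :: "bool list \<times> bool list \<times> bool list \<Rightarrow> bool list"
  define \<Delta>2 where "\<Delta>2 n = noise_expectation n p2 p3 (\<lambda>ys zs. avg_distortion hamming n (map snd zs)
        (xor_list ys (fst (snd (g n (message (f n) ys zs) ys)))))" for n
  have ev: "\<forall>\<^sub>F n in sequentially. is_code n R (f n) (g n) \<and> n > 0"
    using code eventually_gt_at_top[of 0] by (rule eventually_conj)
  have "\<Delta>2 \<longlonglongrightarrow> l2"
    by (rule Lim_transform_eventually[OF lim2])
      (use ev in eventually_elim, use p in \<open>auto simp: \<Delta>2_def code_distortions\<close>)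
  \<comment> \<open>Whichever constraint attains the minimum supplies the estimate of X1: the
    reconstruction of X1 itself, or that of S with its distortion mapped back by d to (d - p) / (1 -
    2 p).\<close>
  have "\<exists>sel l. l \<le> D \<and> (\<lambda>n. \<Delta> n sel) \<longlonglongrightarrow> l"
  proof (cases "D = D1")
    case True
    have "(\<lambda>n. \<Delta> n fst) \<longlonglongrightarrow> l1"
      by (rule Lim_transform_eventually[OF lim1])
        (use ev in eventually_elim, use p in \<open>auto simp: \<Delta>_def code_distortions\<close>)
    then show ?thesis using l1 True by blast
  next
    case False
    have "(\<lambda>n. p + (1 - 2 * p) * \<Delta> n (\<lambda>x. snd (snd x))) \<longlonglongrightarrow> ls"
      by (rule Lim_transform_eventually[OF lims])
        (use ev in eventually_elim, use p in \<open>auto simp: \<Delta>_def code_distortions\<close>)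
    then have "(\<lambda>n. (p + (1 - 2 * p) * \<Delta> n (\<lambda>x. snd (snd x)) - p) / (1 - 2 * p)) \<longlonglongrightarrow> (ls - p) / (1 - 2 * p)"
      using p by (intro tendsto_intros) auto
    then have "(\<lambda>n. \<Delta> n (\<lambda>x. snd (snd x))) \<longlonglongrightarrow> (ls - p) / (1 - 2 * p)"
      using p by simp
    moreover have "(ls - p) / (1 - 2 * p) \<le> D"
      using False ls p by (auto simp: D_def min_def divide_right_mono)
    ultimately show ?thesis by blast
  qed
  then obtain sel l where l: "l \<le> D" "(\<lambda>n. \<Delta> n sel) \<longlonglongrightarrow> l" by blast
  \<comment> \<open>The slack e is split between the two dual kernels, which attain the rate only up
    to an arbitrary positive error.\<close>
  have "rate p2 D + rate p3 D2 \<le> R + e" if "e > 0" for e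
  proof -
    obtain v \<alpha> \<beta> where v: "\<And>c z. 0 \<le> v c z" "\<And>c. (\<Sum>z\<in>UNIV. v c z) = 1"
      "\<And>c z. z \<in> set_pmf (bernoulli_pmf p2) \<Longrightarrow> 0 < v c z"
      "\<And>c z. z \<in> set_pmf (bernoulli_pmf p2) \<Longrightarrow>
        log 2 (v c z / pmf (bernoulli_pmf p2) z) = \<alpha> z + \<beta> * hamming z c"
      "\<beta> \<le> 0" "rate p2 D - e / 2 \<le> measure_pmf.expectation (bernoulli_pmf p2) \<alpha> + \<beta> * D"
      using dual_kernel[of p2 D "e / 2"] q \<open>0 \<le> D\<close> \<open>e > 0\<close> by (metis half_gt_zero)
    obtain w \<gamma> \<delta> where w: "\<And>c z. 0 \<le> w c z" "\<And>c. (\<Sum>z\<in>UNIV. w c z) = 1"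
      "\<And>c z. z \<in> set_pmf (bernoulli_pmf p3) \<Longrightarrow> 0 < w c z"
      "\<And>c z. z \<in> set_pmf (bernoulli_pmf p3) \<Longrightarrow>
        log 2 (w c z / pmf (bernoulli_pmf p3) z) = \<gamma> z + \<delta> * hamming z c"
      "\<delta> \<le> 0" "rate p3 D2 - e / 2 \<le> measure_pmf.expectation (bernoulli_pmf p3) \<gamma> + \<delta> * D2"
      using dual_kernel[of p3 D2 "e / 2"] q D \<open>e > 0\<close> by (metis half_gt_zero)
    let ?A = "measure_pmf.expectation (bernoulli_pmf p2) \<alpha> + measure_pmf.expectation (bernoulli_pmf p3) \<gamma>"
    have "(\<lambda>n. ?A + \<beta> * \<Delta> n sel + \<delta> * \<Delta>2 n) \<longlonglongrightarrow> ?A + \<beta> * l + \<delta> * l2"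
      by (intro tendsto_intros l \<open>\<Delta>2 \<longlonglongrightarrow> l2\<close>)
    moreover have "\<forall>\<^sub>F n in sequentially. ?A + \<beta> * \<Delta> n sel + \<delta> * \<Delta>2 n \<le> R"
      using ev
    proof eventually_elim
      case (elim n)
      let ?Y = "replicate_pmf n (bernoulli_pmf (1 / 2))"
      let ?Ez = "measure_pmf.expectation (replicate_pmf n (pair_pmf (bernoulli_pmf p2) (bernoulli_pmf p3)))"
      \<comment> \<open>For fixed \<open>ys\<close>, these are the codewords for the two noise
        sequences, indexed by the message alone.\<close>
      define a where "a ys m = xor_list ys (sel (g n m ys))" for ys m
      define b where "b ys m = xor_list ys (fst (snd (g n m ys)))" for ys m
      have "?A + \<beta> * \<Delta> n sel + \<delta> * \<Delta>2 n = measure_pmf.expectation ?Y (\<lambda>ys. ?A +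
        \<beta> * ?Ez (\<lambda>zs. avg_distortion hamming n (map fst zs) (a ys (message (f n) ys zs))) +
        \<delta> * ?Ez (\<lambda>zs. avg_distortion hamming n (map snd zs) (b ys (message (f n) ys zs))))"
        by (simp add: \<Delta>_def \<Delta>2_def noise_expectation_def a_def b_def)
      also have "\<dots> \<le> R"
      proof (rule measure_pmf.integral_le_const)
        show "AE ys in ?Y. ?A +
          \<beta> * ?Ez (\<lambda>zs. avg_distortion hamming n (map fst zs) (a ys (message (f n) ys zs))) +
          \<delta> * ?Ez (\<lambda>zs. avg_distortion hamming n (map snd zs) (b ys (message (f n) ys zs))) \<le> R"
        proof (rule AE_pmfI)
          fix ys assume "ys \<in> set_pmf ?Y"
          then have "length ys = n" by (rule length_set_replicate_pmf)
          then have "message (f n) ys zs \<in> messages n R" if "length zs = n" for zs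
            using elim that by (auto simp: is_code_def message_def)
          moreover have "real (card (messages n R)) \<le> 2 powr (real n * R)"
            unfolding card_messages by (rule of_nat_floor) simp
          ultimately show "?A +
            \<beta> * ?Ez (\<lambda>zs. avg_distortion hamming n (map fst zs) (a ys (message (f n) ys zs))) +
            \<delta> * ?Ez (\<lambda>zs. avg_distortion hamming n (map snd zs) (b ys (message (f n) ys zs))) \<le> R"
            using elim v(1-4) w(1-4)
            by (intro dual_bound[where K = "messages n R" and v = v and w = w and \<phi> = "message (f n) ys"]) auto
        qed
      qed simp
      finally show ?case .
    qed
    ultimately have "?A + \<beta> * l + \<delta> * l2 \<le> R"
      by (rule tendsto_upperbound) simp
    \<comment> \<open>Nonpositive slopes turn the upper bounds on the limiting distortions into
      lower bounds on the dual value.\<close>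
    moreover have "\<beta> * D \<le> \<beta> * l" "\<delta> * D2 \<le> \<delta> * l2"
      using v(5) w(5) l l2 by (auto intro: mult_left_mono_neg)
    ultimately show ?thesis using v(6) w(6) by linarith
  qed
  then show ?thesis unfolding D_def by (rule field_le_epsilon)
qed

section \<open>Codes built from two separate quantizers\<close>

lemma product_code:
  assumes C: "finite C1" "finite C2" "real (card C1) \<le> 2 powr (real n * R1)" "real (card C2) \<le> 2 powr (real n * R2)"
    and len: "\<And>c. c \<in> C1 \<Longrightarrow> length c = n" "\<And>c. c \<in> C2 \<Longrightarrow> length c = n"
    and \<phi>: "\<And>zs. \<phi>1 zs \<in> C1" "\<And>zs. \<phi>2 zs \<in> C2"
    and "n > 0" "0 \<le> p" "p \<le> 1"
  obtains f g where "is_code n (R1 + R2) f g"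
    "code_expectation (source p p2 p3) n f g (\<lambda>s x1 x2 x1h x2h sh. avg_distortion hamming n x1 x1h) =
      measure_pmf.expectation (replicate_pmf n (bernoulli_pmf p2)) (\<lambda>zs. avg_distortion hamming n zs (\<phi>1 zs))"
    "code_expectation (source p p2 p3) n f g (\<lambda>s x1 x2 x1h x2h sh. avg_distortion hamming n x2 x2h) =
      measure_pmf.expectation (replicate_pmf n (bernoulli_pmf p3)) (\<lambda>zs. avg_distortion hamming n zs (\<phi>2 zs))"
    "code_expectation (source p p2 p3) n f g (\<lambda>s x1 x2 x1h x2h sh. avg_distortion hamming n s sh) =
      p + (1 - 2 * p) *
      measure_pmf.expectation (replicate_pmf n (bernoulli_pmf p2)) (\<lambda>zs. avg_distortion hamming n zs (\<phi>1 zs))"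
proof -
  have "real (card (C1 \<times> C2)) \<le> 2 powr (real n * R1) * 2 powr (real n * R2)"
    using C by (simp add: card_cartesian_product mult_mono)
  then have "card (C1 \<times> C2) \<le> card (messages n (R1 + R2))"
    unfolding card_messages by (intro le_nat_floor) (simp add: distrib_left powr_add)
  \<comment> \<open>An injective numbering of the codeword pairs by messages; it exists because an
    integer at most 2 powr (n (R1 + R2)) is at most its floor.\<close>
  then obtain e where e: "e ` (C1 \<times> C2) \<subseteq> messages n (R1 + R2)" "inj_on e (C1 \<times> C2)"
    using card_le_inj[of "C1 \<times> C2" "messages n (R1 + R2)"] C by auto
  \<comment> \<open>Messages that number no pair are decoded to a default pair of codewords, since
    \<open>is_code\<close> demands outputs of length n for every message.\<close>
  define d where "d m = (if m \<in> e ` (C1 \<times> C2) then inv_into (C1 \<times> C2) e m else (\<phi>1 [], \<phi>2 []))" for m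
  have d_in: "fst (d m) \<in> C1" "snd (d m) \<in> C2" for m
    using inv_into_into[of m e "C1 \<times> C2"] \<phi> by (auto simp: d_def mem_Times_iff)
  have d_e: "d (e (c1, c2)) = (c1, c2)" if "c1 \<in> C1" "c2 \<in> C2" for c1 c2
    using that e by (simp add: d_def)
  define f :: "(bool, bool, bool) encoder"
    where "f x1 x2 y = e (\<phi>1 (xor_list y x1), \<phi>2 (xor_list y x2))" for x1 x2 y
  \<comment> \<open>S is reconstructed by the same word as X1, so no extra rate is spent on
    it.\<close>
  define g :: "(bool, bool, bool, bool) decoder"
    where "g m y = (xor_list y (fst (d m)), xor_list y (snd (d m)), xor_list y (fst (d m)))" for m y
  have code: "is_code n (R1 + R2) f g"
    using e \<phi> len d_in by (auto simp: is_code_def f_def g_def)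
  have g1: "xor_list ys (fst (g (message f ys zs) ys)) = \<phi>1 (map fst zs)"
    "xor_list ys (snd (snd (g (message f ys zs) ys))) = \<phi>1 (map fst zs)"
    and g2: "xor_list ys (fst (snd (g (message f ys zs) ys))) = \<phi>2 (map snd zs)"
    if "length ys = n" "length zs = n" for ys zs
    using that len \<phi> by (auto simp: g_def message_def f_def d_e)
  have marg1: "noise_expectation n p2 p3 (\<lambda>ys zs. h (map fst zs)) =
    measure_pmf.expectation (replicate_pmf n (bernoulli_pmf p2)) h" for h
    using map_replicate_pmf[of fst n "pair_pmf (bernoulli_pmf p2) (bernoulli_pmf p3)", symmetric]
    by (simp add: noise_expectation_def map_fst_pair_pmf)
  have marg2: "noise_expectation n p2 p3 (\<lambda>ys zs. h (map snd zs)) =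
    measure_pmf.expectation (replicate_pmf n (bernoulli_pmf p3)) h" for h
    using map_replicate_pmf[of snd n "pair_pmf (bernoulli_pmf p2) (bernoulli_pmf p3)", symmetric]
    by (simp add: noise_expectation_def map_snd_pair_pmf)
  show thesis
  proof (rule that[OF code])
  qed (simp_all add: code_distortions[OF code \<open>n > 0\<close> \<open>0 \<le> p\<close> \<open>p \<le> 1\<close>] g1 g2
      flip: marg1[of "\<lambda>zs. avg_distortion hamming n zs (\<phi>1 zs)"] marg2[of "\<lambda>zs. avg_distortion hamming n zs (\<phi>2 zs)"]
      cong: noise_expectation_cong)
qed

text \<open>Achievability demands convergent distortions from a single sequence of codes, whereas random
  coding only yields, for each tolerance, codes at all large block lengths; a nearly optimal choice
  at each block length works for all tolerances at once.\<close>

lemma eventually_choose_convergent: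
  fixes B :: "nat \<Rightarrow> 'x \<Rightarrow> real"
  assumes nonneg: "\<And>n x. 0 \<le> B n x"
    and ex: "\<And>\<delta>. \<delta> > 0 \<Longrightarrow> \<forall>\<^sub>F n in sequentially. \<exists>x. A n x \<and> B n x \<le> \<delta>"
  obtains X where "\<forall>\<^sub>F n in sequentially. A n (X n)" "(\<lambda>n. B n (X n)) \<longlonglongrightarrow> 0"
proof -
  have "\<exists>x. A n x \<and> (\<forall>x'. A n x' \<longrightarrow> B n x \<le> B n x' + inverse (real (Suc n)))" if ne: "\<exists>x. A n x" for n
  proof -
    let ?S = "B n ` {x. A n x}"
    have bdd: "bdd_below ?S" using nonneg by (intro bdd_belowI[of _ 0]) auto
    obtain b where "b \<in> ?S" "b < Inf ?S + inverse (real (Suc n))"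
      using cInf_lessD[of ?S "Inf ?S + inverse (real (Suc n))"] ne by auto
    then obtain x where x: "A n x" "B n x < Inf ?S + inverse (real (Suc n))" by auto
    have "Inf ?S \<le> B n x'" if "A n x'" for x'
      using bdd that by (intro cInf_lower) auto
    with x show ?thesis by (intro exI[of _ x]) force
  qed
  then obtain X where X: "\<And>n. \<exists>x. A n x \<Longrightarrow> A n (X n)"
    "\<And>n x'. A n x' \<Longrightarrow> B n (X n) \<le> B n x' + inverse (real (Suc n))" by metis
  have "\<forall>\<^sub>F n in sequentially. A n (X n)"
    using ex[of 1] by (auto elim!: eventually_mono intro: X)
  moreover have "(\<lambda>n. B n (X n)) \<longlonglongrightarrow> 0"
  proof (rule order_tendstoI)
    fix a :: real assume "a < 0"
    then show "\<forall>\<^sub>F n in sequentially. a < B n (X n)"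
      using nonneg by (auto intro!: always_eventually intro: less_le_trans)
  next
    fix a :: real assume "0 < a"
    have "\<forall>\<^sub>F n in sequentially. inverse (real (Suc n)) < a / 2"
      using \<open>0 < a\<close> LIMSEQ_inverse_real_of_nat by (intro order_tendstoD) auto
    then show "\<forall>\<^sub>F n in sequentially. B n (X n) < a"
      using ex[of "a / 2", OF half_gt_zero[OF \<open>0 < a\<close>]]
    proof eventually_elim
      case (elim n)
      then obtain x where "A n x" "B n x \<le> a / 2" by blast
      with X(2)[OF \<open>A n x\<close>] elim show ?case by linarith
    qed
  qed
  ultimately show thesis by (rule that)
qed

text \<open>Clipping D at q absorbs the indicator, because for D \<ge> q both sides are 0.\<close>

lemma rate_eq: "0 \<le> D \<Longrightarrow> rate q D = h_b q - h_b (min D q)"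
  by (auto simp: rate_def indicator_def min_def)

text \<open>The slack e is shared by the two quantizers and makes both of their rates strictly
  exceed the required ones and positive.\<close>

lemma achievability:
  assumes p: "0 \<le> p" "p < 1 / 2" and q: "0 \<le> p2" "p2 \<le> 1 / 2" "0 \<le> p3" "p3 \<le> 1 / 2"
    and D: "0 \<le> D1" "0 \<le> D2" "p \<le> Ds" and "0 < e"
  shows "achievable (source p p2 p3) (hamming :: bool \<Rightarrow> bool \<Rightarrow> real)
      (hamming :: bool \<Rightarrow> bool \<Rightarrow> real) (hamming :: bool \<Rightarrow> bool \<Rightarrow> real)
      (rate p2 (min D1 ((Ds - p) / (1 - 2 * p))) + rate p3 D2 + e) D1 D2 Ds"
proof -
  define D where "D = min D1 ((Ds - p) / (1 - 2 * p))"
  have "0 \<le> D" using D p by (simp add: D_def)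
  \<comment> \<open>Targets are clipped at the noise parameters, as the quantizer requires; smaller
    limiting distortions still meet the constraints.\<close>
  define L1 where "L1 = min D p2"
  define L2 where "L2 = min D2 p3"
  define R1 where "R1 = rate p2 D + e / 2"
  define R2 where "R2 = rate p3 D2 + e / 2"
  have L: "0 \<le> L1" "L1 \<le> p2" "0 \<le> L2" "L2 \<le> p3"
    using q D \<open>0 \<le> D\<close> by (auto simp: L1_def L2_def)
  have "rate p2 D = h_b p2 - h_b L1" "rate p3 D2 = h_b p3 - h_b L2"
    using rate_eq \<open>0 \<le> D\<close> D by (auto simp: L1_def L2_def)
  then have R: "h_b p2 - h_b L1 < R1" "0 < R1" "h_b p3 - h_b L2 < R2" "0 < R2"
    using h_b_mono[OF L(1,2)] h_b_mono[OF L(3,4)] q \<open>0 < e\<close> by (auto simp: R1_def R2_def)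
  let ?P = "source p p2 p3"
  let ?d1 = "\<lambda>n f g. code_expectation ?P n f g (\<lambda>s x1 x2 x1h x2h sh. avg_distortion hamming n x1 x1h)"
  let ?d2 = "\<lambda>n f g. code_expectation ?P n f g (\<lambda>s x1 x2 x1h x2h sh. avg_distortion hamming n x2 x2h)"
  let ?ds = "\<lambda>n f g. code_expectation ?P n f g (\<lambda>s x1 x2 x1h x2h sh. avg_distortion hamming n s sh)"
  let ?Ls = "p + (1 - 2 * p) * L1"
  \<comment> \<open>All three deviations are collected in one nonnegative quantity, so that a single
    choice of codes makes the three distortions converge.\<close>
  define B where "B n x = \<bar>?d1 n (fst x) (snd x) - L1\<bar> + \<bar>?d2 n (fst x) (snd x) - L2\<bar> + \<bar>?ds n (fst x) (snd x) - ?Ls\<bar>"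
    for n and x :: "(bool, bool, bool) encoder \<times> (bool, bool, bool, bool) decoder"
  have "\<forall>\<^sub>F n in sequentially. \<exists>x. is_code n (R1 + R2) (fst x) (snd x) \<and> B n x \<le> \<delta>" if "\<delta> > 0" for \<delta>
  proof -
    have "0 < \<delta> / 3" using that by simp
    show ?thesis
      using bernoulli_quantizer[OF L(1,2) q(2) R(1,2) \<open>0 < \<delta> / 3\<close>]
        bernoulli_quantizer[OF L(3,4) q(4) R(3,4) \<open>0 < \<delta> / 3\<close>] eventually_gt_at_top[of 0]
    proof eventually_elim
      case (elim n)
      then obtain \<phi>1 C1 \<phi>2 C2 where C1: "finite C1" "real (card C1) \<le> 2 powr (real n * R1)"
          "\<And>c. c \<in> C1 \<Longrightarrow> length c = n" "\<And>zs. \<phi>1 zs \<in> C1"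
          "\<bar>measure_pmf.expectation (replicate_pmf n (bernoulli_pmf p2)) (\<lambda>zs. avg_distortion hamming n zs (\<phi>1 zs)) - L1\<bar> \<le> \<delta> / 3"
        and C2: "finite C2" "real (card C2) \<le> 2 powr (real n * R2)"
          "\<And>c. c \<in> C2 \<Longrightarrow> length c = n" "\<And>zs. \<phi>2 zs \<in> C2"
          "\<bar>measure_pmf.expectation (replicate_pmf n (bernoulli_pmf p3)) (\<lambda>zs. avg_distortion hamming n zs (\<phi>2 zs)) - L2\<bar> \<le> \<delta> / 3"
        by blast
      have "p \<le> 1" using p by simp
      obtain f g where fg: "is_code n (R1 + R2) f g"
        "?d1 n f g = measure_pmf.expectation (replicate_pmf n (bernoulli_pmf p2)) (\<lambda>zs. avg_distortion hamming n zs (\<phi>1 zs))"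
        "?d2 n f g = measure_pmf.expectation (replicate_pmf n (bernoulli_pmf p3)) (\<lambda>zs. avg_distortion hamming n zs (\<phi>2 zs))"
        "?ds n f g = p + (1 - 2 * p) * measure_pmf.expectation (replicate_pmf n (bernoulli_pmf p2)) (\<lambda>zs. avg_distortion hamming n zs (\<phi>1 zs))"
        by (rule product_code[OF C1(1) C2(1) C1(2) C2(2) C1(3) C2(3) C1(4) C2(4) \<open>0 < n\<close> p(1) \<open>p \<le> 1\<close>])
      \<comment> \<open>The deviation for S is a contraction of that for X1, so each of the three
        deviations is at most a third of \<delta>.\<close>
      have "?ds n f g - ?Ls = (1 - 2 * p) * (?d1 n f g - L1)"
        unfolding fg by (simp add: algebra_simps)
      then have "\<bar>?ds n f g - ?Ls\<bar> \<le> 1 * \<bar>?d1 n f g - L1\<bar>"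
        unfolding abs_mult using p by (simp only: abs_mult) (intro mult_right_mono, auto)
      moreover have "x + y + z \<le> \<delta>" if "x \<le> \<delta> / 3" "y \<le> \<delta> / 3" "z \<le> 1 * x" for x y z :: real
        using that by linarith
      ultimately have "B n (f, g) \<le> \<delta>"
        using C1(5) C2(5) unfolding B_def fst_conv snd_conv fg(2,3) by blast
      then show ?case using fg(1) by (intro exI[of _ "(f, g)"]) simp
    qed
  qed
  moreover have "0 \<le> B n x" for n x by (simp add: B_def)
  ultimately obtain X where X: "\<forall>\<^sub>F n in sequentially. is_code n (R1 + R2) (fst (X n)) (snd (X n))"
    "(\<lambda>n. B n (X n)) \<longlonglongrightarrow> 0"
    using eventually_choose_convergent[where B = B and A = "\<lambda>n x. is_code n (R1 + R2) (fst x) (snd x)"] by blast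
  have conv: "F \<longlonglongrightarrow> l" if "\<And>n. \<bar>F n - l\<bar> \<le> B n (X n)" for F :: "nat \<Rightarrow> real" and l
    by (rule LIM_zero_cancel, rule Lim_null_comparison[OF _ X(2)]) (use that in auto)
  have "(\<lambda>n. ?d1 n (fst (X n)) (snd (X n))) \<longlonglongrightarrow> L1" "(\<lambda>n. ?d2 n (fst (X n)) (snd (X n))) \<longlonglongrightarrow> L2" "(\<lambda>n. ?ds n (fst (X n)) (snd (X n))) \<longlonglongrightarrow> ?Ls"
    by (rule conv, simp add: B_def)+
  moreover have "L1 \<le> D1" "L2 \<le> D2" by (auto simp: L1_def L2_def D_def)
  moreover have "?Ls \<le> Ds"
  proof -
    have "L1 \<le> (Ds - p) / (1 - 2 * p)" by (simp add: L1_def D_def)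
    then show ?thesis using p by (simp add: field_simps)
  qed
  moreover have "rate p2 D + rate p3 D2 + e = R1 + R2" by (simp add: R1_def R2_def)
  moreover have "0 \<le> R1 + R2" "0 \<le> Ds" using R p D by auto
  ultimately show ?thesis
    unfolding achievable_def D_def[symmetric] using X(1) D
    by (intro conjI exI[of _ "\<lambda>n. fst (X n)"] exI[of _ "\<lambda>n. snd (X n)"]) auto
qed

theorem theorem5:
  fixes M :: "'w measure" and S X1 X2 Y :: "'w \<Rightarrow> bool"
    and p p2 p3 D1 D2 Ds :: real
  assumes "prob_space M"
    and "S \<in> M \<rightarrow>\<^sub>M count_space UNIV" and "X1 \<in> M \<rightarrow>\<^sub>M count_space UNIV"
    and "X2 \<in> M \<rightarrow>\<^sub>M count_space UNIV" and "Y \<in> M \<rightarrow>\<^sub>M count_space UNIV"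
    and "0 \<le> p" "p < 1 / 2"
    and "0 \<le> p2" "p2 \<le> 1 / 2"
    and "0 \<le> p3" "p3 \<le> 1 / 2"
    and "DSBS M p S X1" and "DSBS M p2 X1 Y" and "DSBS M p3 X2 Y"
    and "markov_chain M S X1 (\<lambda>\<omega>. (X2 \<omega>, Y \<omega>))"
    and "markov_chain M X1 Y X2"
    and "0 \<le> D1" and "0 \<le> D2" and "p \<le> Ds"
  shows "rate_distortion (pmf_of_rv M (\<lambda>\<omega>. (S \<omega>, X1 \<omega>, X2 \<omega>, Y \<omega>)))
           (hamming :: bool \<Rightarrow> bool \<Rightarrow> real) (hamming :: bool \<Rightarrow> bool \<Rightarrow> real)
           (hamming :: bool \<Rightarrow> bool \<Rightarrow> real) D1 D2 Ds =
         (let Ds0 = (Ds - p) / (1 - 2 * p) in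
            (h_b p3 - h_b D2) * indicator {0..p3} D2 +
            (h_b p2 - h_b (min D1 Ds0)) * indicator {0..p2} (min D1 Ds0))"
proof -
  let ?R = "rate p2 (min D1 ((Ds - p) / (1 - 2 * p))) + rate p3 D2"
  let ?A = "{R. achievable (source p p2 p3) (hamming :: bool \<Rightarrow> bool \<Rightarrow> real)
      (hamming :: bool \<Rightarrow> bool \<Rightarrow> real) (hamming :: bool \<Rightarrow> bool \<Rightarrow> real) R D1 D2 Ds}"
  have source: "pmf_of_rv M (\<lambda>\<omega>. (S \<omega>, X1 \<omega>, X2 \<omega>, Y \<omega>)) = source p p2 p3"
    by (rule pmf_of_rv_eq_source[OF assms(1-6) _ assms(8) _ assms(10) _ assms(12-16)])
      (use assms(7,9,11) in linarith)+
  have ach: "?R + e \<in> ?A" if "0 < e" for e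
    unfolding mem_Collect_eq using that by (rule achievability[OF assms(6-11,17-19)])
  have conv: "?R \<le> R" if "R \<in> ?A" for R
    using that unfolding mem_Collect_eq by (rule converse[OF assms(6-11,17-19)])
  have "Inf ?A = ?R"
  proof (rule antisym)
    have "bdd_below ?A" by (intro bdd_belowI[of _ ?R] conv)
    \<comment> \<open>Achievability is established only strictly above \<open>?R\<close>, so the
      upper bound on the infimum comes from letting e tend to 0.\<close>
    then have "Inf ?A \<le> ?R + e" if "0 < e" for e
      by (intro cInf_lower ach that)
    then show "Inf ?A \<le> ?R" by (rule field_le_epsilon)
    show "?R \<le> Inf ?A"
    proof (rule cInf_greatest)
      show "?A \<noteq> {}" using ach[OF zero_less_one] by blast
    qed (rule conv)
  qed
  then show ?thesis
    by (simp add: rate_distortion_def source rate_def Let_def add.commute)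
qed

end
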